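(* Let $V\subseteq S(\mathbb K)$ be a BK-space such that $e_n\in V$ for all $n\in\mathbb N$. The following are equivalent: i. $\{e_n\}_n$ is a (Schauder) basis of $V$. ii. The representation operator $R_{V,X}:M_\Sigma(V,X)\to\mathcal L(V,X)$ is an isometric isomorphism for every Banach space $X\ne\{0\}$. iii. The representation operator $R_{V,X}:M_\Sigma(V,X)\to\mathcal L(V,X)$ is an isometric isomorphism for some Banach space $X\ne\{0\}$.
   Context: $\mathbb K=\mathbb R$ or $\mathbb C$. $S(X)$ is the vector space of all sequences in $X$ (functions $\mathbb N\to X$); $e_n\in S(\mathbb K)$ is the $n$-th canonical sequence. A BK-space in $S(\mathbb K)$ is a vector subspace with a complete norm for which every coordinate map $v\mapsto v(n)$ is continuous. $\mathcal L(V,X)$ is the space of bounded linear operators with the operator norm. For a Banach space $X$, $M_\Sigma(V,X):=\{f\in S(X):\sum_n v(n)f(n)\text{ converges in }X\ \forall v\in V\}$, with norm $\|f\|_{M_\Sigma(V,X)}:=\sup\{\|\sum_{n=1}^\infty v(n)f(n)\|:\|v\|_V\le1\}$ (this supremum is finite). The representation operator is $R_{V,X}f(v):=\sum_{n=1}^\infty v(n)f(n)$. An isometric isomorphism is a bijective linear map preserving norms. *)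

theory Defs
  imports "HOL-Analysis.Analysis" "HOL-Algebra.Module"
begin

section \<open>Normed and Banach spaces with explicit carrier\<close>

text \<open>
  Banach spaces are carrier-based, so that ``for every'' and ``for some Banach space'' can be
  quantified inside a proposition. The scalar field is a set \<open>K\<close> of complex numbers, either
  \<open>\<real>\<close> or \<open>UNIV\<close>; in both cases the absolute value is the norm of \<^typ>\<open>complex\<close>.
\<close>

definition scalar_field :: "complex set \<Rightarrow> complex ring" where
  "scalar_field K =
     \<lparr>carrier = K, monoid.mult = (*), one = 1, ring.zero = 0, add = (+)\<rparr>"

text \<open>
  The fields \<^const>\<open>monoid.mult\<close> and \<^const>\<open>monoid.one\<close> that modules inherit from rings are
  not used.
\<close>

record 'a normed = "(complex, 'a) module" +
  nrm :: "'a \<Rightarrow> real"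

locale normed_space = module "scalar_field K" X
  for K :: "complex set" and X :: "'a normed" (structure) +
  assumes nrm_eq_0_iff: "x \<in> carrier X \<Longrightarrow> nrm X x = 0 \<longleftrightarrow> x = \<zero>\<^bsub>X\<^esub>"
    and nrm_triangle:
      "x \<in> carrier X \<Longrightarrow> y \<in> carrier X \<Longrightarrow> nrm X (x \<oplus>\<^bsub>X\<^esub> y) \<le> nrm X x + nrm X y"
    and nrm_smult: "c \<in> K \<Longrightarrow> x \<in> carrier X \<Longrightarrow> nrm X (c \<odot>\<^bsub>X\<^esub> x) = norm c * nrm X x"

text \<open>
  \<^locale>\<open>Metric_space\<close> demands nonnegativity and symmetry on the whole type, hence the value
  \<open>0\<close> outside the carrier.
\<close>

definition nrm_dist :: "'a normed \<Rightarrow> 'a \<Rightarrow> 'a \<Rightarrow> real" where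
  "nrm_dist X x y =
     (if x \<in> carrier X \<and> y \<in> carrier X then nrm X (x \<ominus>\<^bsub>X\<^esub> y) else 0)"

definition nrm_topology :: "'a normed \<Rightarrow> 'a topology" where
  "nrm_topology X = Metric_space.mtopology (carrier X) (nrm_dist X)"

definition banach_space :: "complex set \<Rightarrow> 'a normed \<Rightarrow> bool" where
  "banach_space K X \<longleftrightarrow>
     normed_space K X \<and> Metric_space.mcomplete (carrier X) (nrm_dist X)"

definition series_sums :: "'a normed \<Rightarrow> (nat \<Rightarrow> 'a) \<Rightarrow> 'a \<Rightarrow> bool" where
  "series_sums X f s \<longleftrightarrow>
     limitin (nrm_topology X) (\<lambda>N. \<Oplus>\<^bsub>X\<^esub>n\<in>{..<N}. f n) s sequentially"

definition series_converges :: "'a normed \<Rightarrow> (nat \<Rightarrow> 'a) \<Rightarrow> bool" where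
  "series_converges X f \<longleftrightarrow> (\<exists>s. series_sums X f s)"

definition series_sum :: "'a normed \<Rightarrow> (nat \<Rightarrow> 'a) \<Rightarrow> 'a" where
  "series_sum X f = (THE s. series_sums X f s)"

definition schauder_basis :: "complex set \<Rightarrow> 'a normed \<Rightarrow> (nat \<Rightarrow> 'a) \<Rightarrow> bool" where
  "schauder_basis K X b \<longleftrightarrow>
     (\<forall>n. b n \<in> carrier X) \<and>
     (\<forall>x\<in>carrier X. \<exists>!a. (\<forall>n. a n \<in> K) \<and> series_sums X (\<lambda>n. a n \<odot>\<^bsub>X\<^esub> b n) x)"


section \<open>Operators\<close>

definition linear_map :: "complex set \<Rightarrow> 'a normed \<Rightarrow> 'b normed \<Rightarrow> ('a \<Rightarrow> 'b) \<Rightarrow> bool" where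
  "linear_map K X Y T \<longleftrightarrow>
     T \<in> carrier X \<rightarrow> carrier Y \<and>
     (\<forall>x\<in>carrier X. \<forall>y\<in>carrier X. T (x \<oplus>\<^bsub>X\<^esub> y) = T x \<oplus>\<^bsub>Y\<^esub> T y) \<and>
     (\<forall>c\<in>K. \<forall>x\<in>carrier X. T (c \<odot>\<^bsub>X\<^esub> x) = c \<odot>\<^bsub>Y\<^esub> T x)"

definition isometric_isomorphism ::
  "complex set \<Rightarrow> 'a normed \<Rightarrow> 'b normed \<Rightarrow> ('a \<Rightarrow> 'b) \<Rightarrow> bool" where
  "isometric_isomorphism K X Y T \<longleftrightarrow>
     linear_map K X Y T \<and> bij_betw T (carrier X) (carrier Y) \<and>
     (\<forall>x\<in>carrier X. nrm Y (T x) = nrm X x)"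

text \<open>
  The space of bounded linear operators. Its elements are functions on \<open>carrier X\<close>, represented
  canonically by \<^const>\<open>extensional\<close> functions on the whole type.
\<close>

definition blin_space :: "complex set \<Rightarrow> 'a normed \<Rightarrow> 'b normed \<Rightarrow> ('a \<Rightarrow> 'b) normed" where
  "blin_space K X Y =
     \<lparr>carrier = {T \<in> extensional (carrier X). linear_map K X Y T \<and>
                   (\<exists>C. \<forall>x\<in>carrier X. nrm Y (T x) \<le> C * nrm X x)},
      monoid.mult = undefined, one = undefined,
      ring.zero = (\<lambda>x\<in>carrier X. \<zero>\<^bsub>Y\<^esub>),
      add = (\<lambda>S T. \<lambda>x\<in>carrier X. S x \<oplus>\<^bsub>Y\<^esub> T x),
      smult = (\<lambda>c T. \<lambda>x\<in>carrier X. c \<odot>\<^bsub>Y\<^esub> T x),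
      nrm = (\<lambda>T. SUP x\<in>{x \<in> carrier X. nrm X x \<le> 1}. nrm Y (T x))\<rparr>"


section \<open>Sequence spaces\<close>

definition sequence_module :: "complex set \<Rightarrow> (complex, nat \<Rightarrow> complex) module" where
  "sequence_module K =
     \<lparr>carrier = {v. \<forall>n. v n \<in> K},
      monoid.mult = undefined, one = undefined,
      ring.zero = (\<lambda>_. 0), add = (\<lambda>u v n. u n + v n), smult = (\<lambda>c v n. c * v n)\<rparr>"

definition canonical_seq :: "nat \<Rightarrow> nat \<Rightarrow> complex" where
  "canonical_seq n = (\<lambda>k. if k = n then 1 else 0)"

definition bk_space :: "complex set \<Rightarrow> (nat \<Rightarrow> complex) normed \<Rightarrow> bool" where
  "bk_space K V \<longleftrightarrow>
     submodule (carrier V) (scalar_field K) (sequence_module K) \<and>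
     ring.zero V = ring.zero (sequence_module K) \<and>
     add V = add (sequence_module K) \<and>
     smult V = smult (sequence_module K) \<and>
     banach_space K V \<and>
     (\<forall>n. continuous_map (nrm_topology V) euclidean (\<lambda>v. v n))"

text \<open>The operator \<open>R\<^bsub>V,X\<^esub>\<close> mapping \<open>f\<close> to \<open>v \<mapsto> \<Sum>n. v n \<cdot> f n\<close>.\<close>

definition rep_op ::
  "(nat \<Rightarrow> complex) normed \<Rightarrow> 'a normed \<Rightarrow> (nat \<Rightarrow> 'a) \<Rightarrow> (nat \<Rightarrow> complex) \<Rightarrow> 'a" where
  "rep_op V X f = (\<lambda>v\<in>carrier V. series_sum X (\<lambda>n. v n \<odot>\<^bsub>X\<^esub> f n))"

text \<open>The space \<open>M\<^sub>\<Sigma>(V,X)\<close>.\<close>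

definition M_Sigma :: "(nat \<Rightarrow> complex) normed \<Rightarrow> 'a normed \<Rightarrow> (nat \<Rightarrow> 'a) normed" where
  "M_Sigma V X =
     \<lparr>carrier = {f. (\<forall>n. f n \<in> carrier X) \<and>
                   (\<forall>v\<in>carrier V. series_converges X (\<lambda>n. v n \<odot>\<^bsub>X\<^esub> f n))},
      monoid.mult = undefined, one = undefined,
      ring.zero = (\<lambda>_. \<zero>\<^bsub>X\<^esub>),
      add = (\<lambda>f g n. f n \<oplus>\<^bsub>X\<^esub> g n),
      smult = (\<lambda>c f n. c \<odot>\<^bsub>X\<^esub> f n),
      nrm = (\<lambda>f. SUP v\<in>{v \<in> carrier V. nrm V v \<le> 1}.
                    nrm X (series_sum X (\<lambda>n. v n \<odot>\<^bsub>X\<^esub> f n)))\<rparr>"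


section \<open>Well-formedness\<close>

lemma cring_scalar_field:
  assumes "K = \<real> \<or> K = UNIV"
  shows "cring (scalar_field K)"
proof -
  have "\<exists>y\<in>K. y + x = 0" if "x \<in> K" for x :: complex
    using that assms by (intro bexI[of _ "- x"]) auto
  then show ?thesis
    using assms
    by (intro cringI abelian_groupI comm_monoidI)
       (auto simp: scalar_field_def algebra_simps)
qed

lemma module_sequence_module:
  assumes "K = \<real> \<or> K = UNIV"
  shows "module (scalar_field K) (sequence_module K)"
proof -
  have "\<exists>y. (\<forall>n. y n \<in> K) \<and> (\<lambda>n. y n + x n) = (\<lambda>_. 0)" if "\<forall>n. x n \<in> K"
    for x :: "nat \<Rightarrow> complex"
    using that assms by (intro exI[of _ "\<lambda>n. - x n"]) auto
  then show ?thesis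
    using assms
    by (intro moduleI cring_scalar_field abelian_groupI)
       (auto simp: scalar_field_def sequence_module_def algebra_simps)
qed

context normed_space
begin

lemma minus_one_scalar: "- 1 \<in> K" and minus_one_smult: "x \<in> carrier X \<Longrightarrow> (- 1) \<odot> x = \<ominus> x"
proof -
  let ?F = "scalar_field K"
  have one: "\<one>\<^bsub>?F\<^esub> = 1" and zero: "\<zero>\<^bsub>?F\<^esub> = 0" and add: "a \<oplus>\<^bsub>?F\<^esub> b = a + b" for a b
    by (simp_all add: scalar_field_def)
  have "\<ominus>\<^bsub>?F\<^esub> \<one>\<^bsub>?F\<^esub> \<oplus>\<^bsub>?F\<^esub> \<one>\<^bsub>?F\<^esub> = \<zero>\<^bsub>?F\<^esub>"
    by (simp add: R.l_neg)
  then have eq: "\<ominus>\<^bsub>?F\<^esub> \<one>\<^bsub>?F\<^esub> = - 1"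
    unfolding add one zero by (simp add: add_eq_0_iff2)
  have "\<ominus>\<^bsub>?F\<^esub> \<one>\<^bsub>?F\<^esub> \<in> carrier ?F"
    by simp
  then show "- 1 \<in> K"
    unfolding eq by (simp add: scalar_field_def)
  show "(- 1) \<odot> x = \<ominus> x" if "x \<in> carrier X"
    using smult_l_minus[of "\<one>\<^bsub>?F\<^esub>" x] that unfolding eq by simp
qed

lemma nrm_minus: "x \<in> carrier X \<Longrightarrow> nrm X (\<ominus> x) = nrm X x"
  using nrm_smult[OF minus_one_scalar, of x] by (simp add: minus_one_smult)

lemma nrm_nonneg: "x \<in> carrier X \<Longrightarrow> 0 \<le> nrm X x"
  using nrm_triangle[of x "\<ominus> x"] nrm_minus[of x] nrm_eq_0_iff[of \<zero>]
  by (simp add: M.r_neg)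

lemma Metric_space_nrm_dist: "Metric_space (carrier X) (nrm_dist X)"
proof
  fix x y
  show "0 \<le> nrm_dist X x y"
    by (simp add: nrm_dist_def nrm_nonneg)
  show "nrm_dist X x y = nrm_dist X y x"
    using nrm_minus[of "x \<ominus> y"]
    by (auto simp: nrm_dist_def M.minus_eq M.minus_add M.a_comm)
next
  fix x y assume xy: "x \<in> carrier X" "y \<in> carrier X"
  have "x \<ominus> y = \<zero> \<longleftrightarrow> x = y"
    using xy M.minus_equality[of x "\<ominus> y"] by (auto simp: M.minus_eq M.r_neg)
  then show "nrm_dist X x y = 0 \<longleftrightarrow> x = y"
    using xy by (simp add: nrm_dist_def nrm_eq_0_iff)
next
  fix x y z assume xyz: "x \<in> carrier X" "y \<in> carrier X" "z \<in> carrier X"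
  have "(x \<ominus> y) \<oplus> (y \<ominus> z) = x \<ominus> z"
    using xyz by (simp add: M.minus_eq M.a_assoc M.r_neg1 M.r_neg2)
  then show "nrm_dist X x z \<le> nrm_dist X x y + nrm_dist X y z"
    using nrm_triangle[of "x \<ominus> y" "y \<ominus> z"] xyz by (simp add: nrm_dist_def)
qed

end

end

theory Submission
  imports Defs
begin

text \<open>
  If \<open>e\<^sub>n\<close> is a basis, then \<open>v = \<Sum>n. v n e\<^sub>n\<close>, so a bounded operator \<open>T\<close> is represented by
  \<open>f n = T e\<^sub>n\<close>; conversely \<open>R f\<close> is bounded by the uniform boundedness principle, \<open>R f e\<^sub>n = f n\<close>
  gives injectivity, and the norms agree by definition. If the representation operator is onto for
  one \<open>X \<noteq> {0}\<close>, then representing the rank-one operators \<open>v \<mapsto> \<psi> v \<cdot> x\<close> shows that the truncations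
  of \<open>v\<close> converge weakly to \<open>v\<close>. Hence they are bounded, by uniform boundedness on the dual, and so
  uniformly bounded as operators on \<open>V\<close>; by Hahn-Banach the finite sequences are dense, so the
  truncations converge in norm.
\<close>

section \<open>Normed spaces over the real or complex numbers\<close>

text \<open>Weak convergence of a sequence does not imply norm convergence in general. The converse
  direction succeeds because truncations act linearly on all of \<open>V\<close> at once and
  eventually fix each finite sequence. Both scalar fields are treated together: Hahn-Banach and the
  boundedness arguments use real-linear functionals throughout, and \<open>real_linear_Re\<close>
  restores linearity over \<open>K\<close> at the one place where a functional has to become an
  operator into \<open>X\<close>. Uniform boundedness on the dual takes the form of a gliding hump,
  so the dual never has to be set up as a Banach space.\<close>

locale scalar_normed_space = normed_space +
  assumes scalars: "K = \<real> \<or> K = UNIV"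
begin

sublocale Met: Metric_space "carrier X" "nrm_dist X"
  by (rule Metric_space_nrm_dist)

text \<open>Rescaling by arbitrary reals is what \<open>scalars\<close> buys:
  \<open>normed_space\<close> alone also admits smaller fields, such as the rationals.\<close>

lemma of_real_scalar [simp]: "of_real t \<in> K"
  using scalars by auto

lemma smult_in_carrier [simp]: "c \<in> K \<Longrightarrow> x \<in> carrier X \<Longrightarrow> c \<odot> x \<in> carrier X"
  using smult_closed[of c x] by (simp add: scalar_field_def)

lemma smult_add_left:
  "a \<in> K \<Longrightarrow> b \<in> K \<Longrightarrow> x \<in> carrier X \<Longrightarrow> (a + b) \<odot> x = a \<odot> x \<oplus> b \<odot> x"
  using smult_l_distr[of a b x] by (simp add: scalar_field_def)

lemma smult_add_right:
  "c \<in> K \<Longrightarrow> x \<in> carrier X \<Longrightarrow> y \<in> carrier X \<Longrightarrow> c \<odot> (x \<oplus> y) = c \<odot> x \<oplus> c \<odot> y"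
  using smult_r_distr[of c x y] by (simp add: scalar_field_def)

lemma smult_mult:
  "a \<in> K \<Longrightarrow> b \<in> K \<Longrightarrow> x \<in> carrier X \<Longrightarrow> (a * b) \<odot> x = a \<odot> (b \<odot> x)"
  using smult_assoc1[of a b x] by (simp add: scalar_field_def)

lemma smult_1 [simp]: "x \<in> carrier X \<Longrightarrow> 1 \<odot> x = x"
  using smult_one[of x] by (simp add: scalar_field_def)

lemma smult_0 [simp]: "x \<in> carrier X \<Longrightarrow> 0 \<odot> x = \<zero>"
  using smult_l_null[of x] by (simp add: scalar_field_def)

lemma smult_diff_left:
  assumes "a \<in> K" "b \<in> K" "x \<in> carrier X"
  shows "(a - b) \<odot> x = a \<odot> x \<ominus> b \<odot> x"
proof -
  have "- b \<in> K"
    using assms scalars by auto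
  then have "(a + - b) \<odot> x = a \<odot> x \<oplus> (-1 * b) \<odot> x"
    using assms by (subst smult_add_left) auto
  also have "(-1 * b) \<odot> x = \<ominus> (b \<odot> x)"
    using assms minus_one_scalar by (subst smult_mult) (auto simp: minus_one_smult)
  finally show ?thesis
    by (simp add: a_minus_def)
qed

lemma smult_diff_right:
  assumes "c \<in> K" "x \<in> carrier X" "y \<in> carrier X"
  shows "c \<odot> (x \<ominus> y) = c \<odot> x \<ominus> c \<odot> y"
  using assms smult_r_minus[of c y]
  by (simp add: M.minus_eq smult_add_right scalar_field_def)

lemma nrm_zero [simp]: "nrm X \<zero> = 0"
  by (simp add: nrm_eq_0_iff)

lemma nrm_smult_real: "x \<in> carrier X \<Longrightarrow> nrm X (of_real t \<odot> x) = \<bar>t\<bar> * nrm X x"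
  by (simp add: nrm_smult)

lemma nrm_triangle_diff:
  "x \<in> carrier X \<Longrightarrow> y \<in> carrier X \<Longrightarrow> nrm X (x \<ominus> y) \<le> nrm X x + nrm X y"
  using nrm_triangle[of x "\<ominus> y"] by (simp add: M.minus_eq nrm_minus)

lemma diff_add_cancel_left:
  "x \<in> carrier X \<Longrightarrow> y \<in> carrier X \<Longrightarrow> (x \<oplus> y) \<ominus> x = y"
  by (simp add: M.minus_eq M.a_comm[of x y] M.a_assoc M.r_neg)

lemma add_diff_cancel:
  "x \<in> carrier X \<Longrightarrow> y \<in> carrier X \<Longrightarrow> x \<oplus> (y \<ominus> x) = y"
  by (simp add: M.minus_eq M.a_comm[of y] M.r_neg2)

lemma diff_diff_cancel_left:
  "x \<in> carrier X \<Longrightarrow> y \<in> carrier X \<Longrightarrow> x \<ominus> (x \<ominus> y) = y"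
  by (simp add: M.minus_eq M.minus_add M.r_neg2)

lemma add_diff_add:
  assumes "a \<in> carrier X" "b \<in> carrier X" "c \<in> carrier X" "d \<in> carrier X"
  shows "(a \<oplus> b) \<ominus> (c \<oplus> d) = (a \<ominus> c) \<oplus> (b \<ominus> d)"
  using assms by (simp add: M.minus_eq M.minus_add M.a_ac)

section \<open>Convergence of sequences and series in norm\<close>

lemma limitin_nrm:
  assumes "\<And>n. f n \<in> carrier X"
  shows "limitin (nrm_topology X) f s sequentially \<longleftrightarrow>
    s \<in> carrier X \<and> (\<lambda>n. nrm X (f n \<ominus> s)) \<longlonglongrightarrow> 0"
  using assms by (auto simp: nrm_topology_def Met.limitin_metric_dist_null nrm_dist_def)

lemma limitin_nrm_unique:
  "limitin (nrm_topology X) f s sequentially \<Longrightarrow> limitin (nrm_topology X) f t sequentially \<Longrightarrow> s = t"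
  unfolding nrm_topology_def by (rule Met.limitin_metric_unique) auto

lemma tendsto_nrm:
  assumes "\<And>n. f n \<in> carrier X" "limitin (nrm_topology X) f s sequentially"
  shows "(\<lambda>n. nrm X (f n)) \<longlonglongrightarrow> nrm X s"
proof -
  have s: "s \<in> carrier X" and lim: "(\<lambda>n. nrm X (f n \<ominus> s)) \<longlonglongrightarrow> 0"
    using assms by (auto simp: limitin_nrm)
  have "\<bar>nrm X (f n) - nrm X s\<bar> \<le> nrm X (f n \<ominus> s)" for n
  proof -
    have "nrm X (f n) \<le> nrm X s + nrm X (f n \<ominus> s)"
      using nrm_triangle[of s "f n \<ominus> s"] assms(1) s by (simp add: add_diff_cancel)
    moreover have "nrm X s \<le> nrm X (f n) + nrm X (f n \<ominus> s)"
      using nrm_triangle_diff[of "f n" "f n \<ominus> s"] assms(1) s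
      by (simp add: diff_diff_cancel_left)
    ultimately show ?thesis
      by linarith
  qed
  then have "(\<lambda>n. nrm X (f n) - nrm X s) \<longlonglongrightarrow> 0"
    by (intro Lim_null_comparison[OF _ lim]) auto
  then show ?thesis
    by (simp add: LIM_zero_iff)
qed

lemma limitin_add:
  assumes f: "\<And>n. f n \<in> carrier X" and g: "\<And>n. g n \<in> carrier X"
    and lim: "limitin (nrm_topology X) f s sequentially" "limitin (nrm_topology X) g t sequentially"
  shows "limitin (nrm_topology X) (\<lambda>n. f n \<oplus> g n) (s \<oplus> t) sequentially"
proof -
  have s: "s \<in> carrier X" "(\<lambda>n. nrm X (f n \<ominus> s)) \<longlonglongrightarrow> 0"
    and t: "t \<in> carrier X" "(\<lambda>n. nrm X (g n \<ominus> t)) \<longlonglongrightarrow> 0"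
    using lim f g by (auto simp: limitin_nrm)
  have "norm (nrm X ((f n \<oplus> g n) \<ominus> (s \<oplus> t))) \<le> nrm X (f n \<ominus> s) + nrm X (g n \<ominus> t)" for n
    using f[of n] g[of n] s t nrm_triangle[of "f n \<ominus> s" "g n \<ominus> t"]
    by (simp add: add_diff_add nrm_nonneg)
  moreover have "(\<lambda>n. nrm X (f n \<ominus> s) + nrm X (g n \<ominus> t)) \<longlonglongrightarrow> 0"
    using tendsto_add[OF s(2) t(2)] by simp
  ultimately have "(\<lambda>n. nrm X ((f n \<oplus> g n) \<ominus> (s \<oplus> t))) \<longlonglongrightarrow> 0"
    by (rule Lim_null_comparison[OF always_eventually[OF allI]])
  then show ?thesis
    using f g s t by (simp add: limitin_nrm)
qed

lemma limitin_smult: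
  assumes f: "\<And>n. f n \<in> carrier X" and c: "c \<in> K"
    and lim: "limitin (nrm_topology X) f s sequentially"
  shows "limitin (nrm_topology X) (\<lambda>n. c \<odot> f n) (c \<odot> s) sequentially"
proof -
  have s: "s \<in> carrier X" "(\<lambda>n. nrm X (f n \<ominus> s)) \<longlonglongrightarrow> 0"
    using lim f by (auto simp: limitin_nrm)
  have "nrm X (c \<odot> f n \<ominus> c \<odot> s) = norm c * nrm X (f n \<ominus> s)" for n
    using f s c by (simp flip: smult_diff_right add: nrm_smult)
  then show ?thesis
    using f s c tendsto_mult_right_zero[OF s(2)] by (simp add: limitin_nrm)
qed

lemma series_sums_carrier: "series_sums X f s \<Longrightarrow> s \<in> carrier X"
  unfolding series_sums_def nrm_topology_def by (metis limitin_topspace Met.topspace_mtopology)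

lemma series_sum_eq: "series_sums X f s \<Longrightarrow> series_sum X f = s"
  unfolding series_sum_def series_sums_def using limitin_nrm_unique by blast

lemma series_sums_add:
  assumes "\<And>n. f n \<in> carrier X" "\<And>n. g n \<in> carrier X" "series_sums X f s" "series_sums X g t"
  shows "series_sums X (\<lambda>n. f n \<oplus> g n) (s \<oplus> t)"
proof -
  have "(\<Oplus>n\<in>{..<N}. f n \<oplus> g n) = (\<Oplus>n\<in>{..<N}. f n) \<oplus> (\<Oplus>n\<in>{..<N}. g n)" for N :: nat
    using assms(1,2) by (intro M.finsum_addf) auto
  then show ?thesis
    using assms unfolding series_sums_def by (auto intro!: limitin_add M.finsum_closed)
qed

lemma series_sums_smult:
  assumes "\<And>n. f n \<in> carrier X" "c \<in> K" "series_sums X f s"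
  shows "series_sums X (\<lambda>n. c \<odot> f n) (c \<odot> s)"
proof -
  have "(\<Oplus>n\<in>{..<N}. c \<odot> f n) = c \<odot> (\<Oplus>n\<in>{..<N}. f n)" for N :: nat
    using assms(1,2) finsum_smult_ldistr[of "{..<N}" c f] by (simp add: scalar_field_def)
  then show ?thesis
    using assms unfolding series_sums_def by (auto intro!: limitin_smult M.finsum_closed)
qed

text \<open>The partial sums are constant from \<open>m + 1\<close> on. This is the series that
  \<open>rep_op\<close> meets at a canonical sequence.\<close>

lemma series_sums_single:
  assumes x: "x \<in> carrier X"
  shows "series_sums X (\<lambda>n. if m = n then x else \<zero>) x"
proof -
  have "(\<Oplus>n\<in>{..<N}. if m = n then x else \<zero>) = x" if "N > m" for N
    using x that by (intro M.finsum_singleton[of m "{..<N}" "\<lambda>_. x", simplified]) auto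
  then have "\<forall>\<^sub>F N in sequentially. (\<Oplus>n\<in>{..<N}. if m = n then x else \<zero>) = x"
    by (rule eventually_mono[OF eventually_gt_at_top])
  then show ?thesis
    using x unfolding series_sums_def nrm_topology_def by (intro limitin_eventually) auto
qed

lemma nrm_finsum_le:
  "(\<And>n. g n \<in> carrier X) \<Longrightarrow> nrm X (\<Oplus>n\<in>{..<N::nat}. g n) \<le> (\<Sum>n<N. nrm X (g n))"
proof (induction N)
  case (Suc N)
  then have "nrm X (g N \<oplus> (\<Oplus>n\<in>{..<N}. g n)) \<le> nrm X (g N) + nrm X (\<Oplus>n\<in>{..<N}. g n)"
    by (intro nrm_triangle) auto
  moreover have "(\<Oplus>n\<in>{..<Suc N}. g n) = g N \<oplus> (\<Oplus>n\<in>{..<N}. g n)"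
    using Suc.prems by (simp add: lessThan_Suc Pi_def)
  ultimately show ?case
    using Suc by simp
qed simp


subsection \<open>Uniform boundedness\<close>

text \<open>Working with seminorms instead of operators lets \<open>norm (v n)\<close> and the norms
  of partial sums be used directly. Nonnegativity follows from
  \<open>0 = p (x - x) <= 2 * p x\<close>.\<close>

definition seminorm :: "('a \<Rightarrow> real) \<Rightarrow> bool" where
  "seminorm p \<longleftrightarrow>
     (\<forall>x\<in>carrier X. \<forall>y\<in>carrier X. p (x \<oplus> y) \<le> p x + p y) \<and>
     (\<forall>c\<in>K. \<forall>x\<in>carrier X. p (c \<odot> x) = norm c * p x)"

lemma seminorm_diff:
  assumes "seminorm p" "x \<in> carrier X" "y \<in> carrier X"
  shows "p (x \<ominus> y) \<le> p x + p y"
proof -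
  have "(-1) \<odot> y \<in> carrier X"
    using assms minus_one_scalar by simp
  then have "p (x \<oplus> (-1) \<odot> y) \<le> p x + p ((-1) \<odot> y)"
    using assms unfolding seminorm_def by blast
  also have "p ((-1) \<odot> y) = p y"
    using assms minus_one_scalar unfolding seminorm_def by simp
  finally show ?thesis
    using assms by (simp add: minus_one_smult M.minus_eq)
qed

lemma seminorm_zero: "seminorm p \<Longrightarrow> p \<zero> = 0"
  using of_real_scalar[of 0] smult_0[of \<zero>] unfolding seminorm_def by fastforce

text \<open>Rescaling \<open>x\<close> to norm \<open>r / 2\<close> moves it into the open ball; the
  factor 2 is the price of staying strictly inside.\<close>

lemma seminorm_bounded_if_bounded_on_ball:
  assumes p: "seminorm p" and r: "r > 0" and x: "x \<in> carrier X"
    and B: "\<And>y. y \<in> carrier X \<Longrightarrow> nrm X y < r \<Longrightarrow> p y \<le> B"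
  shows "p x \<le> 2 * B / r * nrm X x"
proof (cases "x = \<zero>")
  case True
  then show ?thesis
    using p by (simp add: seminorm_zero)
next
  case False
  then have pos: "nrm X x > 0"
    using x nrm_nonneg[OF x] nrm_eq_0_iff[OF x] by linarith
  define t where "t = r / (2 * nrm X x)"
  have t: "t > 0"
    using r pos by (simp add: t_def)
  have "nrm X (of_real t \<odot> x) < r"
    using t r pos by (subst nrm_smult_real[OF x]) (simp add: t_def)
  then have "p (of_real t \<odot> x) \<le> B"
    using B x by simp
  moreover have "p (of_real t \<odot> x) = t * p x"
    using p x t unfolding seminorm_def by simp
  ultimately have "p x \<le> B / t"
    using t by (simp add: field_simps)
  also have "B / t = 2 * B / r * nrm X x"
    using r pos by (simp add: t_def)
  finally show ?thesis .
qed

text \<open>Baire category: the sets \<open>S m\<close>, on which every \<open>p i\<close> is at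
  most \<open>m\<close>, are closed and cover the space, so one of them contains a ball. A common
  bound on a ball is a common bound relative to the norm.\<close>

theorem uniform_boundedness:
  assumes complete: "Met.mcomplete"
    and p: "\<And>i. i \<in> I \<Longrightarrow> seminorm (p i)"
    and bounded: "\<And>i. i \<in> I \<Longrightarrow> \<exists>C. \<forall>x\<in>carrier X. p i x \<le> C * nrm X x"
    and pointwise: "\<And>x. x \<in> carrier X \<Longrightarrow> \<exists>B. \<forall>i\<in>I. p i x \<le> B"
  obtains C where "\<And>i x. i \<in> I \<Longrightarrow> x \<in> carrier X \<Longrightarrow> p i x \<le> C * nrm X x"
proof -
  define S where "S m = {x \<in> carrier X. \<forall>i\<in>I. p i x \<le> real m}" for m
  \<comment> \<open>Each single \<open>p i\<close> is bounded, hence continuous, so the bound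
    \<open>m\<close> survives limits. The constant \<open>C\<close> used here may depend on
    \<open>i\<close>.\<close>
  have closed: "closedin Met.mtopology (S m)" for m
  proof (subst Met.metric_closedin_iff_sequentially_closed, intro conjI allI impI)
    show "S m \<subseteq> carrier X"
      by (auto simp: S_def)
    fix \<sigma> l assume "range \<sigma> \<subseteq> S m \<and> limitin Met.mtopology \<sigma> l sequentially"
    then have \<sigma>: "\<And>k. \<sigma> k \<in> S m" and "limitin (nrm_topology X) \<sigma> l sequentially"
      by (auto simp: nrm_topology_def)
    moreover have \<sigma>X: "\<sigma> k \<in> carrier X" for k
      using \<sigma>[of k] by (simp add: S_def)
    ultimately have l: "l \<in> carrier X" and lim: "(\<lambda>k. nrm X (\<sigma> k \<ominus> l)) \<longlonglongrightarrow> 0"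
      by (simp_all add: limitin_nrm)
    have "p i l \<le> real m" if i: "i \<in> I" for i
    proof -
      obtain C where C: "\<And>x. x \<in> carrier X \<Longrightarrow> p i x \<le> C * nrm X x"
        using bounded[OF i] by blast
      have "p i l \<le> real m + C * nrm X (\<sigma> k \<ominus> l)" for k
      proof -
        have "\<sigma> k \<ominus> (\<sigma> k \<ominus> l) = l"
          using l \<sigma>X[of k] by (rule diff_diff_cancel_left[rotated])
        then have "p i l \<le> p i (\<sigma> k) + p i (\<sigma> k \<ominus> l)"
          using seminorm_diff[OF p[OF i], of "\<sigma> k" "\<sigma> k \<ominus> l"] l \<sigma>X[of k] by simp
        moreover have "p i (\<sigma> k) \<le> real m"
          using \<sigma>[of k] i by (simp add: S_def)
        moreover have "p i (\<sigma> k \<ominus> l) \<le> C * nrm X (\<sigma> k \<ominus> l)"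
          using C l \<sigma>X by simp
        ultimately show ?thesis
          by linarith
      qed
      moreover have "(\<lambda>k. real m + C * nrm X (\<sigma> k \<ominus> l)) \<longlonglongrightarrow> real m + C * 0"
        by (intro tendsto_intros lim)
      ultimately show ?thesis
        using LIMSEQ_le_const[of "\<lambda>k. real m + C * nrm X (\<sigma> k \<ominus> l)" "real m + C * 0" "p i l"] by auto
    qed
    then show "l \<in> S m"
      using l by (simp add: S_def)
  qed
  have "(\<Union>m. S m) = carrier X"
  proof -
    have "x \<in> (\<Union>m. S m)" if x: "x \<in> carrier X" for x
    proof -
      obtain B where "\<forall>i\<in>I. p i x \<le> B"
        using pointwise[OF x] by blast
      then have "x \<in> S (nat \<lceil>B\<rceil>)"
        using x real_nat_ceiling_ge[of B] order_trans unfolding S_def by blast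
      then show ?thesis
        by blast
    qed
    then show ?thesis
      by (auto simp: S_def)
  qed
  moreover have "Met.mtopology interior_of carrier X = carrier X"
    using interior_of_topspace[of Met.mtopology] by simp
  ultimately have "Met.mtopology interior_of (\<Union>(range S)) \<noteq> {}"
    using M.zero_closed by auto
  then obtain m where "Met.mtopology interior_of S m \<noteq> {}"
    using Met.metric_Baire_category_alt[OF complete, of "range S"] closed by auto
  then obtain x where "x \<in> Met.mtopology interior_of S m"
    by blast
  then obtain r where r: "r > 0" and ball: "Met.mball x r \<subseteq> S m" and x: "x \<in> carrier X"
    using openin_interior_of[of Met.mtopology "S m"] interior_of_subset[of Met.mtopology "S m"]
    unfolding Met.openin_mtopology by blast
  \<comment> \<open>\<open>y\<close> is the difference of the points \<open>x + y\<close> and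
    \<open>x\<close> of the ball. This moves the ball to the origin and doubles the bound.\<close>
  have small: "p i y \<le> 2 * real m" if i: "i \<in> I" and y: "y \<in> carrier X" "nrm X y < r" for i y
  proof -
    have "nrm X (x \<ominus> (x \<oplus> y)) < r"
      using x y nrm_minus[of y] by (simp add: M.minus_eq M.minus_add M.r_neg2)
    then have "x \<oplus> y \<in> S m"
      using ball x y by (auto simp: nrm_dist_def)
    moreover have "x \<in> S m"
      using ball r x by auto
    ultimately have "p i (x \<oplus> y) \<le> m" "p i x \<le> m"
      using i by (auto simp: S_def)
    moreover have "p i y \<le> p i (x \<oplus> y) + p i x"
      using seminorm_diff[OF p[OF i], of "x \<oplus> y" x] x y by (simp add: diff_add_cancel_left)
    ultimately show ?thesis
      by linarith
  qed
  \<comment> \<open>One factor 2 comes from moving the ball to the origin, the other from the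
    rescaling to half the radius.\<close>
  show thesis
    by (rule that[of "2 * (2 * real m) / r"], rule seminorm_bounded_if_bounded_on_ball[OF p r])
      (use small in auto)
qed


subsection \<open>The Hahn-Banach theorem\<close>

text \<open>For scaling only an inequality is demanded, as this is what infima and limits deliver
  directly. Equality follows by applying it to \<open>1 / t\<close> as well, see
  \<open>sublinear_smult\<close>.\<close>

definition sublinear :: "('a \<Rightarrow> real) \<Rightarrow> bool" where
  "sublinear p \<longleftrightarrow>
     (\<forall>x\<in>carrier X. \<forall>y\<in>carrier X. p (x \<oplus> y) \<le> p x + p y) \<and>
     (\<forall>t\<ge>0. \<forall>x\<in>carrier X. p (of_real t \<odot> x) \<le> t * p x)"

definition real_linear :: "('a \<Rightarrow> real) \<Rightarrow> bool" where
  "real_linear \<phi> \<longleftrightarrow>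
     (\<forall>x\<in>carrier X. \<forall>y\<in>carrier X. \<phi> (x \<oplus> y) = \<phi> x + \<phi> y) \<and>
     (\<forall>t. \<forall>x\<in>carrier X. \<phi> (of_real t \<odot> x) = t * \<phi> x)"

lemma sublinear_add: "sublinear p \<Longrightarrow> x \<in> carrier X \<Longrightarrow> y \<in> carrier X \<Longrightarrow> p (x \<oplus> y) \<le> p x + p y"
  and sublinear_smult_le: "sublinear p \<Longrightarrow> t \<ge> 0 \<Longrightarrow> x \<in> carrier X \<Longrightarrow> p (of_real t \<odot> x) \<le> t * p x"
  by (auto simp: sublinear_def)

lemma sublinear_zero: "sublinear p \<Longrightarrow> p \<zero> = 0"
  using sublinear_add[of p \<zero> \<zero>] sublinear_smult_le[of p 0 \<zero>] by simp

lemma smult_real_mult: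
  "x \<in> carrier X \<Longrightarrow> of_real s \<odot> (of_real t \<odot> x) = of_real (s * t) \<odot> x"
  using smult_mult[of "of_real s" "of_real t" x] by simp

lemma sublinear_smult:
  assumes p: "sublinear p" and t: "t \<ge> 0" and x: "x \<in> carrier X"
  shows "p (of_real t \<odot> x) = t * p x"
proof (cases "t = 0")
  case True
  then show ?thesis
    using p x by (simp add: sublinear_zero)
next
  case False
  have "of_real (1 / t) \<odot> (of_real t \<odot> x) = x"
    using False smult_real_mult[OF x, of "1 / t" t] x by simp
  then have "p x \<le> 1 / t * p (of_real t \<odot> x)"
    using sublinear_smult_le[OF p, of "1 / t" "of_real t \<odot> x"] t x by simp
  then have "t * p x \<le> p (of_real t \<odot> x)"
    using False t by (simp add: field_simps)
  then show ?thesis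
    using sublinear_smult_le[OF p t x] by linarith
qed

text \<open>Keeps the infimum over a chain finite, and is the half of oddness that every sublinear
  functional has.\<close>

lemma sublinear_minus_ge: "sublinear p \<Longrightarrow> x \<in> carrier X \<Longrightarrow> - p (\<ominus> x) \<le> p x"
  using sublinear_add[of p x "\<ominus> x"] by (simp add: M.r_neg sublinear_zero)

text \<open>
  A minimal sublinear functional cannot be lowered in this way, hence is odd and thus linear: this
  is how Zorn's lemma yields the Hahn-Banach theorem.
\<close>

lemma sublinear_lower:
  assumes p: "sublinear p" and x: "x \<in> carrier X"
  obtains q where "sublinear q" "\<And>y. y \<in> carrier X \<Longrightarrow> q y \<le> p y" "q (\<ominus> x) \<le> - p x"
proof
  \<comment> \<open>Writing \<open>y\<close> as \<open>(y + t x) + t (- x)\<close> shows that any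
    sublinear functional below \<open>p\<close> with value at most \<open>- p x\<close> at
    \<open>- x\<close> is at most \<open>h y t\<close> at \<open>y\<close>. So \<open>q\<close> is
    the largest candidate.\<close>
  define h where "h y t = p (y \<oplus> of_real t \<odot> x) - t * p x" for y t
  define q where "q y = (INF t\<in>{0..}. h y t)" for y
  have lower: "- p (\<ominus> y) \<le> h y t" if y: "y \<in> carrier X" and t: "t \<ge> 0" for y t
  proof -
    have "t * p x = p ((y \<oplus> of_real t \<odot> x) \<oplus> \<ominus> y)"
      using x y sublinear_smult[OF p t x] diff_add_cancel_left[of y "of_real t \<odot> x"]
      by (simp add: M.minus_eq)
    also have "\<dots> \<le> p (y \<oplus> of_real t \<odot> x) + p (\<ominus> y)"
      using x y by (intro sublinear_add[OF p]) auto
    finally show ?thesis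
      by (simp add: h_def)
  qed
  have bdd: "bdd_below (h y ` {0..})" if "y \<in> carrier X" for y
    using lower[OF that] by (auto intro!: bdd_belowI)
  have q_le: "q y \<le> h y t" if "y \<in> carrier X" "t \<ge> 0" for y t
    unfolding q_def using that bdd by (intro cINF_lower) auto
  have q_greatest: "c \<le> q y" if "\<And>t. t \<ge> 0 \<Longrightarrow> c \<le> h y t" for c y
    unfolding q_def using that by (intro cINF_greatest) auto
  show "q y \<le> p y" if "y \<in> carrier X" for y
    using q_le[OF that, of 0] that x by (simp add: h_def)
  show "q (\<ominus> x) \<le> - p x"
    using q_le[of "\<ominus> x" 1] x by (simp add: h_def M.l_neg sublinear_zero[OF p])
  show "sublinear q"
    unfolding sublinear_def
  proof (intro conjI ballI allI impI)
    fix y z assume y: "y \<in> carrier X" and z: "z \<in> carrier X"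
    have *: "q (y \<oplus> z) \<le> h y s + h z t" if "s \<ge> 0" "t \<ge> 0" for s t
    proof -
      have "(y \<oplus> z) \<oplus> of_real (s + t) \<odot> x = (y \<oplus> of_real s \<odot> x) \<oplus> (z \<oplus> of_real t \<odot> x)"
        using x y z by (simp add: smult_add_left M.a_ac)
      then have "h (y \<oplus> z) (s + t) \<le> h y s + h z t"
        using sublinear_add[OF p, of "y \<oplus> of_real s \<odot> x" "z \<oplus> of_real t \<odot> x"] x y z
        by (simp add: h_def algebra_simps)
      then show ?thesis
        using q_le[of "y \<oplus> z" "s + t"] that y z by simp
    qed
    have "q (y \<oplus> z) - h y s \<le> q z" if "s \<ge> 0" for s
      using *[OF that] by (intro q_greatest) (simp add: algebra_simps)
    then have "q (y \<oplus> z) - q z \<le> q y"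
      by (intro q_greatest) (simp add: algebra_simps)
    then show "q (y \<oplus> z) \<le> q y + q z"
      by simp
  next
    fix c :: real and y assume c: "c \<ge> 0" and y: "y \<in> carrier X"
    show "q (of_real c \<odot> y) \<le> c * q y"
    proof (cases "c = 0")
      case True
      then show ?thesis
        using q_le[of \<zero> 0] x y by (simp add: h_def sublinear_zero[OF p])
    next
      case False
      have "q (of_real c \<odot> y) / c \<le> h y t" if t: "t \<ge> 0" for t
      proof -
        have "of_real c \<odot> y \<oplus> of_real (c * t) \<odot> x = of_real c \<odot> (y \<oplus> of_real t \<odot> x)"
          using x y by (simp add: smult_add_right smult_mult)
        then have "h (of_real c \<odot> y) (c * t) = c * h y t"
          using sublinear_smult[OF p c, of "y \<oplus> of_real t \<odot> x"] x y
          by (simp add: h_def algebra_simps)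
        then have "q (of_real c \<odot> y) \<le> c * h y t"
          using q_le[of "of_real c \<odot> y" "c * t"] c t y by simp
        then show ?thesis
          using False c by (simp add: field_simps)
      qed
      then have "q (of_real c \<odot> y) / c \<le> q y"
        by (rule q_greatest)
      then show ?thesis
        using False c by (simp add: field_simps)
    qed
  qed
qed

text \<open>Provides the bounds that Zorn's lemma asks for. An infimum of sublinear functionals need
  not be subadditive; along a chain it is, because the smaller of \<open>q\<close> and
  \<open>r\<close> can serve at both \<open>y\<close> and \<open>z\<close>. The common majorant
  \<open>p\<close> bounds the infimum below, through \<open>- p (- y)\<close>.\<close>

lemma sublinear_INF_chain:
  assumes ne: "C \<noteq> {}" and C: "\<And>q. q \<in> C \<Longrightarrow> sublinear q"
    and le: "\<And>q y. q \<in> C \<Longrightarrow> y \<in> carrier X \<Longrightarrow> q y \<le> p y"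
    and chain: "\<And>q r. q \<in> C \<Longrightarrow> r \<in> C \<Longrightarrow>
      (\<forall>y\<in>carrier X. q y \<le> r y) \<or> (\<forall>y\<in>carrier X. r y \<le> q y)"
  shows "sublinear (\<lambda>y. INF q\<in>C. q y)"
    and "q \<in> C \<Longrightarrow> y \<in> carrier X \<Longrightarrow> (INF q\<in>C. q y) \<le> q y"
proof -
  define u where "u y = (INF q\<in>C. q y)" for y
  have "bdd_below ((\<lambda>q. q y) ` C)" if y: "y \<in> carrier X" for y
  proof (intro bdd_belowI2)
    fix q assume "q \<in> C"
    then show "- p (\<ominus> y) \<le> q y"
      using sublinear_minus_ge[OF C y] le[of q "\<ominus> y"] y by fastforce
  qed
  then have u_le: "u y \<le> q y" if "q \<in> C" "y \<in> carrier X" for q y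
    unfolding u_def using that by (intro cINF_lower) auto
  then show "q \<in> C \<Longrightarrow> y \<in> carrier X \<Longrightarrow> (INF q\<in>C. q y) \<le> q y"
    by (simp add: u_def)
  have u_greatest: "c \<le> u y" if "\<And>q. q \<in> C \<Longrightarrow> c \<le> q y" for c y
    unfolding u_def using that ne by (intro cINF_greatest) auto
  have "sublinear u"
    unfolding sublinear_def
  proof (intro conjI ballI allI impI)
    fix y z assume y: "y \<in> carrier X" and z: "z \<in> carrier X"
    have *: "u (y \<oplus> z) \<le> q y + r z" if q: "q \<in> C" and r: "r \<in> C" for q r
      using chain[OF q r]
    proof
      assume "\<forall>y\<in>carrier X. q y \<le> r y"
      then show ?thesis
        using sublinear_add[OF C[OF q] y z] u_le[OF q, of "y \<oplus> z"] y z by fastforce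
    next
      assume "\<forall>y\<in>carrier X. r y \<le> q y"
      then show ?thesis
        using sublinear_add[OF C[OF r] y z] u_le[OF r, of "y \<oplus> z"] y z by fastforce
    qed
    have "u (y \<oplus> z) - q y \<le> u z" if "q \<in> C" for q
      using *[OF that] by (intro u_greatest) (simp add: algebra_simps)
    then have "u (y \<oplus> z) - u z \<le> u y"
      by (intro u_greatest) (simp add: algebra_simps)
    then show "u (y \<oplus> z) \<le> u y + u z"
      by simp
  next
    fix t :: real and y assume t: "t \<ge> 0" and y: "y \<in> carrier X"
    have *: "u (of_real t \<odot> y) \<le> t * q y" if "q \<in> C" for q
      using u_le[OF that, of "of_real t \<odot> y"] sublinear_smult_le[OF C[OF that] t y] y by simp
    show "u (of_real t \<odot> y) \<le> t * u y"
    proof (cases "t = 0")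
      case True
      then show ?thesis
        using * ne by fastforce
    next
      case False
      have "u (of_real t \<odot> y) / t \<le> u y"
        using * False t by (intro u_greatest) (simp add: field_simps)
      then show ?thesis
        using False t by (simp add: field_simps)
    qed
  qed
  then show "sublinear (\<lambda>y. INF q\<in>C. q y)"
    by (simp add: u_def[abs_def])
qed

lemma real_linear_if_minimal:
  assumes p: "sublinear p"
    and min: "\<And>q y. sublinear q \<Longrightarrow> (\<And>y. y \<in> carrier X \<Longrightarrow> q y \<le> p y) \<Longrightarrow>
      y \<in> carrier X \<Longrightarrow> p y \<le> q y"
  shows "real_linear p"
proof -
  have minus: "p (\<ominus> x) = - p x" if x: "x \<in> carrier X" for x
  proof -
    obtain q where "sublinear q" "\<And>y. y \<in> carrier X \<Longrightarrow> q y \<le> p y" "q (\<ominus> x) \<le> - p x"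
      using sublinear_lower[OF p x] by blast
    then have "p (\<ominus> x) \<le> - p x"
      using min[of q "\<ominus> x"] x by fastforce
    then show ?thesis
      using sublinear_minus_ge[OF p x] by linarith
  qed
  show ?thesis
    unfolding real_linear_def
  proof (intro conjI ballI allI)
    fix x y assume xy: "x \<in> carrier X" "y \<in> carrier X"
    \<comment> \<open>Oddness turns subadditivity at \<open>- x\<close> and \<open>- y\<close> into
      superadditivity at \<open>x\<close> and \<open>y\<close>.\<close>
    show "p (x \<oplus> y) = p x + p y"
      using sublinear_add[OF p, of x y] sublinear_add[OF p, of "\<ominus> x" "\<ominus> y"]
        minus[of x] minus[of y] minus[of "x \<oplus> y"] xy by (simp add: M.minus_add)
  next
    fix t :: real and x assume x: "x \<in> carrier X"
    show "p (of_real t \<odot> x) = t * p x"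
    proof (cases "t \<ge> 0")
      case True
      then show ?thesis
        using sublinear_smult[OF p _ x] by simp
    next
      case False
      define z where "z = of_real (- t) \<odot> x"
      have z: "z \<in> carrier X" and pz: "p z = - t * p x"
        unfolding z_def using False x by (simp_all add: sublinear_smult[OF p] del: of_real_minus)
      have "of_real t \<odot> x = \<ominus> z"
        using smult_real_mult[OF x, of "- 1" "- t"] z by (simp add: z_def flip: minus_one_smult)
      then show ?thesis
        using minus[OF z] pz by simp
    qed
  qed
qed

text \<open>Instead of extending a functional from a subspace, this form supports \<open>p\<close>
  at a point; for \<open>p\<close> the norm it yields norming functionals. The value at
  \<open>x\<close> is forced by starting from \<open>p'\<close>: a minimal functional below
  \<open>p'\<close> is odd and at most \<open>- p x\<close> at \<open>- x\<close>, hence at least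
  \<open>p x\<close> at \<open>x\<close>.\<close>

theorem Hahn_Banach:
  assumes p: "sublinear p" and x: "x \<in> carrier X"
  obtains \<phi> where "real_linear \<phi>" "\<And>y. y \<in> carrier X \<Longrightarrow> \<phi> y \<le> p y" "\<phi> x = p x"
proof -
  obtain p' where p': "sublinear p'" and p'_le: "\<And>y. y \<in> carrier X \<Longrightarrow> p' y \<le> p y"
    and p'_x: "p' (\<ominus> x) \<le> - p x"
    using sublinear_lower[OF p x] by blast
  \<comment> \<open>Extensionality makes the pointwise order antisymmetric. \<open>P\<close> is the
    reversed order, so the maximal element from Zorn's lemma is a minimal functional.\<close>
  define A where
    "A = {q \<in> extensional (carrier X). sublinear q \<and> (\<forall>y\<in>carrier X. q y \<le> p' y)}"
  define P :: "('a \<Rightarrow> real) \<Rightarrow> ('a \<Rightarrow> real) \<Rightarrow> bool"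
    where "P q r \<longleftrightarrow> (\<forall>y\<in>carrier X. r y \<le> q y)" for q r
  have restrict: "sublinear (restrict q (carrier X))" if "sublinear q" for q
    using that unfolding sublinear_def by simp
  have "\<exists>\<phi>\<in>A. \<forall>q\<in>A. P \<phi> q \<longrightarrow> q = \<phi>"
  proof (rule predicate_Zorn)
    show "partial_order_on A (relation_of P A)"
    proof (rule partial_order_on_relation_ofI)
      show "q = r" if "q \<in> A" "r \<in> A" "P q r" "P r q" for q r
        using that by (intro extensionalityI[of _ "carrier X"]) (fastforce simp: A_def P_def)+
    qed (fastforce simp: P_def)+
    fix C assume C: "C \<in> Chains (relation_of P A)"
    show "\<exists>u\<in>A. \<forall>q\<in>C. P q u"
    proof (cases "C = {}")
      case True
      have "restrict p' (carrier X) \<in> A"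
        using p' restrict by (simp add: A_def)
      then show ?thesis
        using True by blast
    next
      case False
      have CA: "q \<in> A" if "q \<in> C" for q
        using C that by (auto simp: Chains_def relation_of_def)
      have chain: "(\<forall>y\<in>carrier X. q y \<le> r y) \<or> (\<forall>y\<in>carrier X. r y \<le> q y)"
        if "q \<in> C" "r \<in> C" for q r
        using C that unfolding Chains_def relation_of_def P_def by blast
      define u where "u = restrict (\<lambda>y. INF q\<in>C. q y) (carrier X)"
      have "sublinear u"
        unfolding u_def
        by (intro restrict sublinear_INF_chain(1)[of C p'] False chain) (use CA in \<open>auto simp: A_def\<close>)
      moreover have u_le: "u y \<le> q y" if "q \<in> C" "y \<in> carrier X" for q y
      proof -
        have "(INF q\<in>C. q y) \<le> q y"
          by (rule sublinear_INF_chain(2)[of C p']) (use CA False chain that in \<open>auto simp: A_def\<close>)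
        then show ?thesis
          using that by (simp add: u_def)
      qed
      moreover have "u y \<le> p' y" if "y \<in> carrier X" for y
        using False CA u_le[OF _ that] that by (fastforce simp: A_def)
      ultimately show ?thesis
        by (intro bexI[of _ u]) (auto simp: P_def A_def u_def)
    qed
  qed
  then obtain \<phi> where \<phi>: "\<phi> \<in> A" and max: "\<And>q. q \<in> A \<Longrightarrow> P \<phi> q \<Longrightarrow> q = \<phi>"
    by blast
  have lin: "real_linear \<phi>"
  proof (rule real_linear_if_minimal)
    show "sublinear \<phi>"
      using \<phi> by (simp add: A_def)
    fix q y assume q: "sublinear q" "\<And>y. y \<in> carrier X \<Longrightarrow> q y \<le> \<phi> y" and y: "y \<in> carrier X"
    have "restrict q (carrier X) \<in> A"
      using \<phi> q restrict[OF q(1)] by (fastforce simp: A_def)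
    then have "restrict q (carrier X) = \<phi>"
      using q(2) by (intro max) (auto simp: P_def)
    then show "\<phi> y \<le> q y"
      using y by (metis order_refl restrict_apply')
  qed
  have le: "\<phi> y \<le> p' y" if "y \<in> carrier X" for y
    using \<phi> that by (simp add: A_def)
  have "\<phi> (\<ominus> x) = - \<phi> x"
    using lin x of_real_scalar minus_one_smult[OF x] unfolding real_linear_def
    by (metis mult_minus1 of_real_1 of_real_minus)
  then have "\<phi> x = p x"
    using le[of "\<ominus> x"] le[of x] p'_le[of x] p'_x x by fastforce
  then show thesis
    using that[OF lin] le p'_le by fastforce
qed


subsection \<open>Weakly bounded sequences\<close>

lemma real_linear_add:
    "real_linear \<phi> \<Longrightarrow> x \<in> carrier X \<Longrightarrow> y \<in> carrier X \<Longrightarrow> \<phi> (x \<oplus> y) = \<phi> x + \<phi> y"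
  and real_linear_smult:
    "real_linear \<phi> \<Longrightarrow> x \<in> carrier X \<Longrightarrow> \<phi> (of_real t \<odot> x) = t * \<phi> x"
  by (auto simp: real_linear_def)

lemma real_linear_minus:
  assumes "real_linear \<phi>" "x \<in> carrier X"
  shows "\<phi> (\<ominus> x) = - \<phi> x"
  using real_linear_smult[OF assms, of "-1"] assms(2) by (simp flip: minus_one_smult)

lemma real_linear_abs_le:
  assumes \<phi>: "real_linear \<phi>" and le: "\<And>y. y \<in> carrier X \<Longrightarrow> \<phi> y \<le> B * nrm X y"
    and x: "x \<in> carrier X"
  shows "\<bar>\<phi> x\<bar> \<le> B * nrm X x"
  using le[OF x] le[of "\<ominus> x"] x by (simp add: real_linear_minus[OF \<phi>] nrm_minus abs_le_iff)

text \<open>In the complex case a linear functional is determined by its real part through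
  \<open>\<psi> x = \<phi> x - i \<phi> (i x)\<close>. The factor 2 is the crude estimate of the
  modulus by real plus imaginary part; later uses need only boundedness.\<close>

lemma real_linear_Re:
  assumes \<phi>: "real_linear \<phi>" and le: "\<And>x. x \<in> carrier X \<Longrightarrow> \<bar>\<phi> x\<bar> \<le> B * nrm X x"
  obtains \<psi> where "\<And>x. x \<in> carrier X \<Longrightarrow> \<psi> x \<in> K"
    "\<And>x y. x \<in> carrier X \<Longrightarrow> y \<in> carrier X \<Longrightarrow> \<psi> (x \<oplus> y) = \<psi> x + \<psi> y"
    "\<And>c x. c \<in> K \<Longrightarrow> x \<in> carrier X \<Longrightarrow> \<psi> (c \<odot> x) = c * \<psi> x"
    "\<And>x. x \<in> carrier X \<Longrightarrow> norm (\<psi> x) \<le> 2 * B * nrm X x"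
    "\<And>x. x \<in> carrier X \<Longrightarrow> Re (\<psi> x) = \<phi> x"
  using scalars
proof
  assume K: "K = \<real>"
  show thesis
  proof (rule that[of "\<lambda>x. of_real (\<phi> x)"])
    show "norm (of_real (\<phi> x) :: complex) \<le> 2 * B * nrm X x" if "x \<in> carrier X" for x
      using le[OF that] by simp
    show "complex_of_real (\<phi> (c \<odot> x)) = c * of_real (\<phi> x)" if "c \<in> K" "x \<in> carrier X" for c x
      using that K by (auto simp: real_linear_smult[OF \<phi>] elim!: Reals_cases)
  qed (auto simp: real_linear_add[OF \<phi>])
next
  assume K: "K = UNIV"
  \<comment> \<open>Used for \<open>c\<close> and for \<open>\<i> * c\<close>, which give the real
    and the imaginary part of homogeneity.\<close>
  have \<phi>_smult: "\<phi> (c \<odot> x) = Re c * \<phi> x + Im c * \<phi> (\<i> \<odot> x)" if x: "x \<in> carrier X" for c x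
  proof -
    have "c \<odot> x = (of_real (Re c) + of_real (Im c) * \<i>) \<odot> x"
      by (metis complex_eq mult.commute)
    also have "\<dots> = of_real (Re c) \<odot> x \<oplus> of_real (Im c) \<odot> (\<i> \<odot> x)"
      using x K by (simp add: smult_add_left smult_mult)
    finally show ?thesis
      using x K by (simp add: real_linear_add[OF \<phi>] real_linear_smult[OF \<phi>])
  qed
  show thesis
  proof (rule that[of "\<lambda>x. Complex (\<phi> x) (- \<phi> (\<i> \<odot> x))"])
    fix x assume x: "x \<in> carrier X"
    have "norm (Complex (\<phi> x) (- \<phi> (\<i> \<odot> x))) \<le> \<bar>\<phi> x\<bar> + \<bar>\<phi> (\<i> \<odot> x)\<bar>"
      using cmod_le[of "Complex (\<phi> x) (- \<phi> (\<i> \<odot> x))"] by simp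
    also have "\<dots> \<le> B * nrm X x + B * nrm X (\<i> \<odot> x)"
      using x K by (intro add_mono le) auto
    also have "\<dots> = 2 * B * nrm X x"
      using x K by (simp add: nrm_smult)
    finally show "norm (Complex (\<phi> x) (- \<phi> (\<i> \<odot> x))) \<le> 2 * B * nrm X x" .
    fix c :: complex
    have "\<i> \<odot> (c \<odot> x) = (\<i> * c) \<odot> x"
      using x K by (simp add: smult_mult)
    then show "Complex (\<phi> (c \<odot> x)) (- \<phi> (\<i> \<odot> (c \<odot> x))) = c * Complex (\<phi> x) (- \<phi> (\<i> \<odot> x))"
      using \<phi>_smult[OF x, of c] \<phi>_smult[OF x, of "\<i> * c"]
      by (simp add: complex_eq_iff algebra_simps)
  qed (use K in \<open>auto simp: real_linear_add[OF \<phi>] smult_add_right complex_eq_iff\<close>)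
qed

text \<open>
  A gliding hump: if \<open>x\<close> were unbounded, choose norming functionals \<open>f k\<close> of \<open>x (N k)\<close>, where
  \<open>nrm X (x (N k)) > k * 3 ^ k\<close>. In \<open>\<Sum>k. \<plusminus> f k / 3 ^ k\<close> with suitable signs, the \<open>k\<close>-th summand
  dominates at \<open>x (N k)\<close> twice the sum of the later ones and is not cancelled by the earlier ones.
\<close>

theorem bounded_if_weakly_bounded:
  assumes x: "\<And>n. x n \<in> carrier X"
    and weak: "\<And>\<phi>. real_linear \<phi> \<Longrightarrow> (\<And>y. y \<in> carrier X \<Longrightarrow> \<bar>\<phi> y\<bar> \<le> 2 * nrm X y) \<Longrightarrow>
      \<exists>B. \<forall>n. \<bar>\<phi> (x n)\<bar> \<le> B"
  shows "\<exists>B. \<forall>n. nrm X (x n) \<le> B"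
proof (rule ccontr)
  assume "\<not> ?thesis"
  then have "\<exists>n. nrm X (x n) > real k * 3 ^ k" for k
    by (meson not_le)
  then obtain N where N: "\<And>k. nrm X (x (N k)) > real k * 3 ^ k"
    by metis
  define y where "y k = x (N k)" for k
  have y: "y k \<in> carrier X" for k
    using x by (simp add: y_def)
  have "sublinear (nrm X)"
    by (auto simp: sublinear_def nrm_triangle nrm_smult_real)
  then have "\<exists>f. real_linear f \<and> (\<forall>z\<in>carrier X. f z \<le> nrm X z) \<and> f (y k) = nrm X (y k)" for k
    using Hahn_Banach[of "nrm X" "y k"] y by metis
  then obtain f where f: "\<And>k. real_linear (f k)"
    and f_le: "\<And>k z. z \<in> carrier X \<Longrightarrow> f k z \<le> nrm X z"
    and f_y: "\<And>k. f k (y k) = nrm X (y k)"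
    by metis
  have f_abs: "\<bar>f k z\<bar> \<le> nrm X z" if "z \<in> carrier X" for k z
    using real_linear_abs_le[OF f, where B = 1] f_le that by simp
  \<comment> \<open>Unlike \<open>sgn\<close>, this sign is 1 at 0; otherwise a summand would be
    lost whenever the earlier ones add up to 0, as happens for \<open>k = 0\<close>.\<close>
  define sg :: "real \<Rightarrow> real" where "sg r = (if r \<ge> 0 then 1 else - 1)" for r
  \<comment> \<open>The recursion runs over whole partial sums because the next sign depends on the
    sum built so far, evaluated at the next point \<open>y k\<close>.\<close>
  define \<psi> where
    "\<psi> = rec_nat (\<lambda>_. 0) (\<lambda>k u z. u z + sg (u (y k)) * (1 / 3) ^ k * f k z)"
  define g where "g k z = sg (\<psi> k (y k)) * (1 / 3) ^ k * f k z" for k z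
  have \<psi>: "\<psi> k z = (\<Sum>j<k. g j z)" for k z
    by (induction k) (simp_all add: \<psi>_def g_def)
  have g_abs: "norm (g k z) \<le> (1 / 3) ^ k * nrm X z" if "z \<in> carrier X" for k z
    using f_abs[OF that, of k] by (simp add: g_def sg_def abs_mult divide_right_mono)
  have geom: "(\<lambda>j. (1 / 3) ^ (j + m) * nrm X z) sums ((1 / 3) ^ m * (3 / 2) * nrm X z)" for m z
    using sums_mult2[OF geometric_sums[of "1 / 3 :: real"], of "(1 / 3) ^ m * nrm X z"]
    by (simp add: power_add mult_ac)
  have summable: "summable (\<lambda>j. g j z)" if z: "z \<in> carrier X" for z
    by (rule summable_comparison_test[of _ "\<lambda>j. (1 / 3) ^ j * nrm X z"])
      (use g_abs[OF z] geom[of 0 z] in \<open>auto simp: sums_iff\<close>)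
  have tail: "\<bar>\<Sum>j. g (j + m) z\<bar> \<le> (1 / 3) ^ m * (3 / 2) * nrm X z" if z: "z \<in> carrier X" for m z
    using norm_suminf_le[of "\<lambda>j. g (j + m) z" "\<lambda>j. (1 / 3) ^ (j + m) * nrm X z"] g_abs[OF z] geom[of m z]
    by (simp add: sums_iff)
  define \<phi> where "\<phi> z = (\<Sum>j. g j z)" for z
  have "real_linear \<phi>"
    unfolding real_linear_def
  proof (intro conjI ballI allI)
    fix u v assume uv: "u \<in> carrier X" "v \<in> carrier X"
    then show "\<phi> (u \<oplus> v) = \<phi> u + \<phi> v"
      using suminf_add[OF summable summable, of u v]
      by (simp add: \<phi>_def g_def real_linear_add[OF f] algebra_simps)
  next
    fix t u assume u: "u \<in> carrier X"
    have "g j (of_real t \<odot> u) = t * g j u" for j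
      using u by (simp add: g_def real_linear_smult[OF f])
    then show "\<phi> (of_real t \<odot> u) = t * \<phi> u"
      using suminf_mult[OF summable[OF u], of t] by (simp add: \<phi>_def)
  qed
  \<comment> \<open>The coefficients add up to at most \<open>3 / 2\<close> in absolute value,
    rounded up to the 2 in \<open>weak\<close>.\<close>
  moreover have "\<bar>\<phi> z\<bar> \<le> 2 * nrm X z" if "z \<in> carrier X" for z
    using tail[OF that, of 0] nrm_nonneg[OF that] by (simp add: \<phi>_def)
  ultimately obtain B where B: "\<And>n. \<bar>\<phi> (x n)\<bar> \<le> B"
    using weak by metis
  have "real k / 2 < B" for k
  proof -
    let ?r = "(1 / 3) ^ k * nrm X (y k)"
    have split: "\<phi> (y k) = (\<Sum>j. g (j + Suc k) (y k)) + \<psi> (Suc k) (y k)"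
      unfolding \<phi>_def \<psi> by (rule suminf_split_initial_segment[OF summable[OF y]])
    \<comment> \<open>This is why the ratio is \<open>1 / 3\<close>: with \<open>1 / 2\<close> the
      tail estimate would equal the hump \<open>?r\<close>, and nothing would be left.\<close>
    have rest: "\<bar>\<Sum>j. g (j + Suc k) (y k)\<bar> \<le> ?r / 2"
      using tail[OF y, of "Suc k" k] by simp
    have step: "\<psi> (Suc k) (y k) = \<psi> k (y k) + sg (\<psi> k (y k)) * ?r"
      using \<psi>[of "Suc k" "y k"] \<psi>[of k "y k"] by (simp add: g_def f_y)
    have "?r \<ge> 0"
      using nrm_nonneg[OF y] by simp
    \<comment> \<open>The new summand has the sign of the old sum, so the absolute values
      add.\<close>
    then have "\<bar>\<psi> (Suc k) (y k)\<bar> \<ge> ?r"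
      unfolding step by (cases "\<psi> k (y k) \<ge> 0") (simp_all add: sg_def)
    then have "\<bar>\<phi> (y k)\<bar> \<ge> ?r / 2"
      using split rest by linarith
    moreover have "?r > real k"
      using N[of k] by (simp add: y_def power_one_over field_simps)
    moreover have "\<bar>\<phi> (y k)\<bar> \<le> B"
      using B by (simp add: y_def)
    ultimately show ?thesis
      by linarith
  qed
  then show False
    using reals_Archimedean2[of "2 * B"] by (smt (verit) field_sum_of_halves)
qed

end


section \<open>The representation operator\<close>

locale representation =
  V: scalar_normed_space K V + X: scalar_normed_space K X
  for K and V :: "(nat \<Rightarrow> complex) normed" and X :: "'x normed" +
  assumes bk: "bk_space K V"
    and canonical: "canonical_seq n \<in> carrier V"
begin

lemma zero_V: "\<zero>\<^bsub>V\<^esub> = (\<lambda>_. 0)"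
  and add_V: "u \<oplus>\<^bsub>V\<^esub> v = (\<lambda>n. u n + v n)"
  and smult_V: "c \<odot>\<^bsub>V\<^esub> v = (\<lambda>n. c * v n)"
  using bk by (simp_all add: bk_space_def sequence_module_def)

lemma coord_in_K: "v \<in> carrier V \<Longrightarrow> v n \<in> K"
  using bk subgroup.subset[of "carrier V" "add_monoid (sequence_module K)"]
  by (auto simp: bk_space_def submodule_def sequence_module_def)

lemma minus_V: "v \<in> carrier V \<Longrightarrow> \<ominus>\<^bsub>V\<^esub> v = (\<lambda>n. - v n)"
  by (simp add: smult_V flip: V.minus_one_smult)

lemma diff_V: "v \<in> carrier V \<Longrightarrow> u \<ominus>\<^bsub>V\<^esub> v = (\<lambda>n. u n - v n)"
  by (simp add: a_minus_def add_V minus_V)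

lemma V_complete: "V.Met.mcomplete"
  using bk by (simp add: bk_space_def banach_space_def)

text \<open>Makes the topological BK condition quantitative: the preimage of the unit disc is a
  neighbourhood of zero, and homogeneity does the rest.\<close>

lemma coord_bounded: "\<exists>C. \<forall>v\<in>carrier V. norm (v n) \<le> C * nrm V v"
proof -
  have "continuous_map V.Met.mtopology euclidean (\<lambda>v. v n)"
    using bk by (simp add: bk_space_def nrm_topology_def)
  then have "openin V.Met.mtopology {v \<in> topspace V.Met.mtopology. v n \<in> ball 0 1}"
    by (rule openin_continuous_map_preimage) simp
  moreover have "\<zero>\<^bsub>V\<^esub> \<in> {v \<in> topspace V.Met.mtopology. v n \<in> ball 0 1}"
    using V.M.zero_closed by (simp add: zero_V)
  ultimately obtain r where r: "r > 0" and ball: "V.Met.mball \<zero>\<^bsub>V\<^esub> r \<subseteq> {v. v n \<in> ball 0 1}"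
    unfolding V.Met.openin_mtopology by blast
  have "norm (v n) \<le> 1" if v: "v \<in> carrier V" "nrm V v < r" for v
  proof -
    have "\<zero>\<^bsub>V\<^esub> \<ominus>\<^bsub>V\<^esub> v = \<ominus>\<^bsub>V\<^esub> v"
      using v by (simp add: V.M.minus_eq)
    then have "v \<in> V.Met.mball \<zero>\<^bsub>V\<^esub> r"
      using v by (simp add: nrm_dist_def V.nrm_minus)
    then show ?thesis
      using ball by fastforce
  qed
  moreover have "V.seminorm (\<lambda>v. norm (v n))"
    by (simp add: V.seminorm_def add_V smult_V norm_triangle_ineq norm_mult)
  ultimately show ?thesis
    using V.seminorm_bounded_if_bounded_on_ball[of "\<lambda>v. norm (v n)" r _ 1] r by blast
qed

section \<open>Partial sums of the representing series\<close>

definition partial_sum :: "(nat \<Rightarrow> 'x) \<Rightarrow> nat \<Rightarrow> (nat \<Rightarrow> complex) \<Rightarrow> 'x" where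
  "partial_sum f N v = (\<Oplus>\<^bsub>X\<^esub>n\<in>{..<N}. v n \<odot>\<^bsub>X\<^esub> f n)"

lemma partial_sum_carrier:
  "(\<And>n. f n \<in> carrier X) \<Longrightarrow> (\<And>n. v n \<in> K) \<Longrightarrow> partial_sum f N v \<in> carrier X"
  by (auto simp: partial_sum_def intro!: X.M.finsum_closed)

lemma partial_sum_0: "partial_sum f 0 v = \<zero>\<^bsub>X\<^esub>"
  and partial_sum_Suc:
    "(\<And>n. f n \<in> carrier X) \<Longrightarrow> (\<And>n. v n \<in> K) \<Longrightarrow>
      partial_sum f (Suc N) v = v N \<odot>\<^bsub>X\<^esub> f N \<oplus>\<^bsub>X\<^esub> partial_sum f N v"
  by (simp_all add: partial_sum_def lessThan_Suc Pi_def)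

lemma partial_sums_limitin:
  "series_sums X (\<lambda>n. v n \<odot>\<^bsub>X\<^esub> f n) s \<longleftrightarrow>
    limitin (nrm_topology X) (\<lambda>N. partial_sum f N v) s sequentially"
  by (simp add: series_sums_def partial_sum_def)

text \<open>For fixed \<open>N\<close> the norm of the partial sum is a seminorm of
  \<open>v\<close>, bounded because finitely many coordinates are. That bound may grow with
  \<open>N\<close>; uniform boundedness on the complete space \<open>V\<close> removes the
  dependence.\<close>

lemma partial_sums_bounded:
  assumes f: "\<And>n. f n \<in> carrier X"
    and pointwise: "\<And>v. v \<in> carrier V \<Longrightarrow> \<exists>B. \<forall>N. nrm X (partial_sum f N v) \<le> B"
  obtains C where "\<And>N v. v \<in> carrier V \<Longrightarrow> nrm X (partial_sum f N v) \<le> C * nrm V v"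
proof -
  have semi: "V.seminorm (\<lambda>v. nrm X (partial_sum f N v))" for N
    unfolding V.seminorm_def
  proof (intro conjI ballI)
    fix u v assume uv: "u \<in> carrier V" "v \<in> carrier V"
    have "partial_sum f N (u \<oplus>\<^bsub>V\<^esub> v) = (\<Oplus>\<^bsub>X\<^esub>n\<in>{..<N}. u n \<odot>\<^bsub>X\<^esub> f n \<oplus>\<^bsub>X\<^esub> v n \<odot>\<^bsub>X\<^esub> f n)"
      unfolding partial_sum_def using f uv coord_in_K
      by (intro X.M.finsum_cong') (auto simp: add_V X.smult_add_left)
    also have "\<dots> = partial_sum f N u \<oplus>\<^bsub>X\<^esub> partial_sum f N v"
      unfolding partial_sum_def using f uv coord_in_K by (intro X.M.finsum_addf) auto
    finally show "nrm X (partial_sum f N (u \<oplus>\<^bsub>V\<^esub> v))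
        \<le> nrm X (partial_sum f N u) + nrm X (partial_sum f N v)"
      using f uv coord_in_K by (simp add: X.nrm_triangle partial_sum_carrier)
  next
    fix c v assume c: "c \<in> K" and v: "v \<in> carrier V"
    have "partial_sum f N (c \<odot>\<^bsub>V\<^esub> v) = (\<Oplus>\<^bsub>X\<^esub>n\<in>{..<N}. c \<odot>\<^bsub>X\<^esub> (v n \<odot>\<^bsub>X\<^esub> f n))"
      unfolding partial_sum_def using f c v coord_in_K
      by (intro X.M.finsum_cong') (auto simp: smult_V X.smult_mult)
    also have "\<dots> = c \<odot>\<^bsub>X\<^esub> partial_sum f N v"
      unfolding partial_sum_def using f c v coord_in_K
        X.finsum_smult_ldistr[of "{..<N}" c "\<lambda>n. v n \<odot>\<^bsub>X\<^esub> f n"]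
      by (simp add: scalar_field_def Pi_def)
    finally show "nrm X (partial_sum f N (c \<odot>\<^bsub>V\<^esub> v)) = norm c * nrm X (partial_sum f N v)"
      using f c v coord_in_K by (simp add: X.nrm_smult partial_sum_carrier)
  qed
  obtain D where D: "\<And>n v. v \<in> carrier V \<Longrightarrow> norm (v n) \<le> D n * nrm V v"
    using coord_bounded by metis
  have bounded: "nrm X (partial_sum f N v) \<le> (\<Sum>n<N. D n * nrm X (f n)) * nrm V v"
    if v: "v \<in> carrier V" for N v
  proof -
    have "nrm X (partial_sum f N v) \<le> (\<Sum>n<N. nrm X (v n \<odot>\<^bsub>X\<^esub> f n))"
      unfolding partial_sum_def using f v coord_in_K by (intro X.nrm_finsum_le) auto
    also have "\<dots> \<le> (\<Sum>n<N. D n * nrm V v * nrm X (f n))"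
      using f v coord_in_K D[OF v] X.nrm_nonneg[OF f]
      by (intro sum_mono) (auto simp: X.nrm_smult mult_right_mono)
    finally show ?thesis
      by (simp add: sum_distrib_left mult_ac)
  qed
  have "\<exists>C. \<forall>v\<in>carrier V. nrm X (partial_sum f N v) \<le> C * nrm V v" for N
    using bounded by blast
  then obtain C where "\<And>N v. N \<in> UNIV \<Longrightarrow> v \<in> carrier V \<Longrightarrow> nrm X (partial_sum f N v) \<le> C * nrm V v"
    using V.uniform_boundedness[OF V_complete, of UNIV "\<lambda>N v. nrm X (partial_sum f N v)"]
      semi pointwise by (metis (no_types, lifting))
  then show thesis
    using that by blast
qed

lemma partial_sums_bounded_if_convergent:
  assumes f: "\<And>n. f n \<in> carrier X" and v: "\<And>n. v n \<in> K"
    and conv: "series_sums X (\<lambda>n. v n \<odot>\<^bsub>X\<^esub> f n) s"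
  shows "\<exists>B. \<forall>N. nrm X (partial_sum f N v) \<le> B"
proof -
  have "(\<lambda>N. nrm X (partial_sum f N v)) \<longlonglongrightarrow> nrm X s"
    using f v conv by (intro X.tendsto_nrm) (auto simp: partial_sums_limitin partial_sum_carrier)
  then have "Bseq (\<lambda>N. nrm X (partial_sum f N v))"
    by (intro convergent_imp_Bseq convergentI)
  then show ?thesis
    by (auto simp: Bseq_def abs_le_iff)
qed

section \<open>Truncations and the basis property\<close>

text \<open>Also applied to sequences outside \<open>V\<close>: the coefficients of a series are not
  known in advance to form an element of \<open>V\<close>, while their truncations do.\<close>

definition trunc :: "nat \<Rightarrow> (nat \<Rightarrow> complex) \<Rightarrow> nat \<Rightarrow> complex" where
  "trunc N v = (\<lambda>k. if k < N then v k else 0)"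

lemma trunc_Suc: "trunc (Suc N) v = v N \<odot>\<^bsub>V\<^esub> canonical_seq N \<oplus>\<^bsub>V\<^esub> trunc N v"
  by (auto simp: trunc_def add_V smult_V canonical_seq_def fun_eq_iff less_Suc_eq)

lemma trunc_0: "trunc 0 v = \<zero>\<^bsub>V\<^esub>"
  by (simp add: trunc_def zero_V)

lemma trunc_carrier: "(\<And>n. v n \<in> K) \<Longrightarrow> trunc N v \<in> carrier V"
  by (induction N) (use canonical in \<open>auto simp: trunc_0 trunc_Suc\<close>)

lemma finsum_canonical:
  assumes "\<And>n. v n \<in> K"
  shows "(\<Oplus>\<^bsub>V\<^esub>n\<in>{..<N}. v n \<odot>\<^bsub>V\<^esub> canonical_seq n) = trunc N v"
  using assms canonical by (induction N) (simp_all add: lessThan_Suc Pi_def trunc_0 trunc_Suc)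

lemma canonical_series_sums:
  assumes "\<And>n. a n \<in> K"
  shows "series_sums V (\<lambda>n. a n \<odot>\<^bsub>V\<^esub> canonical_seq n) v \<longleftrightarrow>
    v \<in> carrier V \<and> (\<lambda>N. nrm V (trunc N a \<ominus>\<^bsub>V\<^esub> v)) \<longlonglongrightarrow> 0"
  using assms by (simp add: series_sums_def finsum_canonical V.limitin_nrm trunc_carrier)

text \<open>Coordinates are continuous, and the \<open>k\<close>-th coordinate of the partial sums
  is \<open>a k\<close> from \<open>N = k + 1\<close> on.\<close>

lemma canonical_series_coeff:
  assumes a: "\<And>n. a n \<in> K" and sums: "series_sums V (\<lambda>n. a n \<odot>\<^bsub>V\<^esub> canonical_seq n) v"
  shows "a = v"
proof
  fix k
  have v: "v \<in> carrier V" and lim: "(\<lambda>N. nrm V (trunc N a \<ominus>\<^bsub>V\<^esub> v)) \<longlonglongrightarrow> 0"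
    using sums canonical_series_sums[OF a] by auto
  obtain C where C: "\<And>u. u \<in> carrier V \<Longrightarrow> norm (u k) \<le> C * nrm V u"
    using coord_bounded by blast
  have "norm (a k - v k) \<le> C * nrm V (trunc N a \<ominus>\<^bsub>V\<^esub> v)" if "N \<ge> Suc k" for N
  proof -
    have "(trunc N a \<ominus>\<^bsub>V\<^esub> v) k = a k - v k"
      using that v by (simp add: diff_V trunc_def)
    then show ?thesis
      using C[of "trunc N a \<ominus>\<^bsub>V\<^esub> v"] trunc_carrier[OF a] v by simp
  qed
  moreover have "(\<lambda>N. C * nrm V (trunc N a \<ominus>\<^bsub>V\<^esub> v)) \<longlonglongrightarrow> 0"
    by (rule tendsto_mult_right_zero[OF lim])
  ultimately have "norm (a k - v k) \<le> 0"
    by (intro LIMSEQ_le_const[of _ 0]) auto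
  then show "a k = v k"
    by simp
qed

text \<open>The coefficients can only be the coordinates of \<open>v\<close>, so uniqueness is
  automatic and the convergence of one explicit sequence remains.\<close>

lemma schauder_basis_iff:
  "schauder_basis K V canonical_seq \<longleftrightarrow>
    (\<forall>v\<in>carrier V. (\<lambda>N. nrm V (trunc N v \<ominus>\<^bsub>V\<^esub> v)) \<longlonglongrightarrow> 0)"
proof
  assume basis: "schauder_basis K V canonical_seq"
  show "\<forall>v\<in>carrier V. (\<lambda>N. nrm V (trunc N v \<ominus>\<^bsub>V\<^esub> v)) \<longlonglongrightarrow> 0"
  proof
    fix v assume v: "v \<in> carrier V"
    then obtain a where a: "\<And>n. a n \<in> K"
      and sums: "series_sums V (\<lambda>n. a n \<odot>\<^bsub>V\<^esub> canonical_seq n) v"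
      using basis unfolding schauder_basis_def by blast
    then have "a = v"
      by (rule canonical_series_coeff)
    then show "(\<lambda>N. nrm V (trunc N v \<ominus>\<^bsub>V\<^esub> v)) \<longlonglongrightarrow> 0"
      using sums canonical_series_sums[OF a] by simp
  qed
next
  assume lim: "\<forall>v\<in>carrier V. (\<lambda>N. nrm V (trunc N v \<ominus>\<^bsub>V\<^esub> v)) \<longlonglongrightarrow> 0"
  have "\<exists>!a. (\<forall>n. a n \<in> K) \<and> series_sums V (\<lambda>n. a n \<odot>\<^bsub>V\<^esub> canonical_seq n) v" if "v \<in> carrier V" for v
  proof (intro ex1I[of _ v] conjI allI)
    show "v n \<in> K" for n
      using that by (rule coord_in_K)
    show "series_sums V (\<lambda>n. v n \<odot>\<^bsub>V\<^esub> canonical_seq n) v"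
      using lim that coord_in_K[OF that] by (simp add: canonical_series_sums)
    show "a = v" if "(\<forall>n. a n \<in> K) \<and> series_sums V (\<lambda>n. a n \<odot>\<^bsub>V\<^esub> canonical_seq n) v" for a
      using that by (intro canonical_series_coeff) auto
  qed
  then show "schauder_basis K V canonical_seq"
    using canonical by (simp add: schauder_basis_def)
qed

section \<open>Linearity, boundedness, injectivity and isometry of the representation
  operator\<close>

lemma M_Sigma_carrier:
  "f \<in> carrier (M_Sigma V X) \<longleftrightarrow>
    (\<forall>n. f n \<in> carrier X) \<and> (\<forall>v\<in>carrier V. \<exists>s. series_sums X (\<lambda>n. v n \<odot>\<^bsub>X\<^esub> f n) s)"
  by (simp add: M_Sigma_def series_converges_def)

lemma rep_op_eq:
  "v \<in> carrier V \<Longrightarrow> series_sums X (\<lambda>n. v n \<odot>\<^bsub>X\<^esub> f n) s \<Longrightarrow> rep_op V X f v = s"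
  by (simp add: rep_op_def X.series_sum_eq)

lemma rep_op_sums:
  assumes "f \<in> carrier (M_Sigma V X)" "v \<in> carrier V"
  shows "series_sums X (\<lambda>n. v n \<odot>\<^bsub>X\<^esub> f n) (rep_op V X f v)"
  using assms rep_op_eq unfolding M_Sigma_carrier by metis

lemma rep_op_carrier: "f \<in> carrier (M_Sigma V X) \<Longrightarrow> v \<in> carrier V \<Longrightarrow> rep_op V X f v \<in> carrier X"
  using rep_op_sums X.series_sums_carrier by blast

lemma rep_op_canonical:
  assumes f: "f \<in> carrier (M_Sigma V X)"
  shows "rep_op V X f (canonical_seq n) = f n"
proof (rule rep_op_eq[OF canonical])
  have "f k \<in> carrier X" for k
    using f by (simp add: M_Sigma_carrier)
  then have "(\<lambda>k. canonical_seq n k \<odot>\<^bsub>X\<^esub> f k) = (\<lambda>k. if n = k then f n else \<zero>\<^bsub>X\<^esub>)"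
    and "f n \<in> carrier X"
    by (auto simp: canonical_seq_def fun_eq_iff)
  then show "series_sums X (\<lambda>k. canonical_seq n k \<odot>\<^bsub>X\<^esub> f k) (f n)"
    by (simp add: X.series_sums_single)
qed

lemma rep_op_add_arg:
  assumes f: "f \<in> carrier (M_Sigma V X)" and uv: "u \<in> carrier V" "v \<in> carrier V"
  shows "rep_op V X f (u \<oplus>\<^bsub>V\<^esub> v) = rep_op V X f u \<oplus>\<^bsub>X\<^esub> rep_op V X f v"
proof (rule rep_op_eq)
  have fX: "f n \<in> carrier X" for n
    using f by (simp add: M_Sigma_carrier)
  have "series_sums X (\<lambda>n. u n \<odot>\<^bsub>X\<^esub> f n \<oplus>\<^bsub>X\<^esub> v n \<odot>\<^bsub>X\<^esub> f n) (rep_op V X f u \<oplus>\<^bsub>X\<^esub> rep_op V X f v)"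
    using f uv fX coord_in_K by (intro X.series_sums_add rep_op_sums) auto
  then show "series_sums X (\<lambda>n. (u \<oplus>\<^bsub>V\<^esub> v) n \<odot>\<^bsub>X\<^esub> f n) (rep_op V X f u \<oplus>\<^bsub>X\<^esub> rep_op V X f v)"
    using fX uv coord_in_K by (simp add: add_V X.smult_add_left)
qed (use uv in simp)

lemma rep_op_smult_arg:
  assumes f: "f \<in> carrier (M_Sigma V X)" and c: "c \<in> K" and v: "v \<in> carrier V"
  shows "rep_op V X f (c \<odot>\<^bsub>V\<^esub> v) = c \<odot>\<^bsub>X\<^esub> rep_op V X f v"
proof (rule rep_op_eq)
  have fX: "f n \<in> carrier X" for n
    using f by (simp add: M_Sigma_carrier)
  have "series_sums X (\<lambda>n. c \<odot>\<^bsub>X\<^esub> (v n \<odot>\<^bsub>X\<^esub> f n)) (c \<odot>\<^bsub>X\<^esub> rep_op V X f v)"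
    using f c v fX coord_in_K by (intro X.series_sums_smult rep_op_sums) auto
  then show "series_sums X (\<lambda>n. (c \<odot>\<^bsub>V\<^esub> v) n \<odot>\<^bsub>X\<^esub> f n) (c \<odot>\<^bsub>X\<^esub> rep_op V X f v)"
    using fX c v coord_in_K by (simp add: smult_V X.smult_mult)
qed (use c v in simp)

lemma rep_op_bounded:
  assumes f: "f \<in> carrier (M_Sigma V X)"
  shows "\<exists>C. \<forall>v\<in>carrier V. nrm X (rep_op V X f v) \<le> C * nrm V v"
proof -
  have fX: "f n \<in> carrier X" for n
    using f by (simp add: M_Sigma_carrier)
  obtain C where C: "\<And>N v. v \<in> carrier V \<Longrightarrow> nrm X (partial_sum f N v) \<le> C * nrm V v"
  proof (rule partial_sums_bounded[OF fX])
    show "\<exists>B. \<forall>N. nrm X (partial_sum f N v) \<le> B" if "v \<in> carrier V" for v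
      using fX coord_in_K[OF that] rep_op_sums[OF f that]
      by (rule partial_sums_bounded_if_convergent)
  qed blast
  have "nrm X (rep_op V X f v) \<le> C * nrm V v" if v: "v \<in> carrier V" for v
  proof (rule LIMSEQ_le_const2)
    show "(\<lambda>N. nrm X (partial_sum f N v)) \<longlonglongrightarrow> nrm X (rep_op V X f v)"
      using fX v coord_in_K rep_op_sums[OF f v]
      by (intro X.tendsto_nrm) (auto simp: partial_sums_limitin partial_sum_carrier)
  qed (use C v in blast)
  then show ?thesis
    by blast
qed

lemma rep_op_in_blin:
  assumes f: "f \<in> carrier (M_Sigma V X)"
  shows "rep_op V X f \<in> carrier (blin_space K V X)"
proof -
  have "rep_op V X f \<in> extensional (carrier V)"
    by (simp add: rep_op_def)
  moreover have "linear_map K V X (rep_op V X f)"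
    unfolding linear_map_def
    by (intro conjI ballI Pi_I rep_op_carrier[OF f] rep_op_add_arg[OF f] rep_op_smult_arg[OF f])
  ultimately show ?thesis
    using rep_op_bounded[OF f] by (simp add: blin_space_def)
qed

lemma rep_op_add:
  assumes f: "f \<in> carrier (M_Sigma V X)" and g: "g \<in> carrier (M_Sigma V X)"
  shows "rep_op V X (f \<oplus>\<^bsub>M_Sigma V X\<^esub> g) = rep_op V X f \<oplus>\<^bsub>blin_space K V X\<^esub> rep_op V X g"
proof -
  have fX: "f n \<in> carrier X" "g n \<in> carrier X" for n
    using f g by (auto simp: M_Sigma_carrier)
  have "rep_op V X (\<lambda>n. f n \<oplus>\<^bsub>X\<^esub> g n) v = rep_op V X f v \<oplus>\<^bsub>X\<^esub> rep_op V X g v"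
    if v: "v \<in> carrier V" for v
  proof (rule rep_op_eq[OF v])
    have "series_sums X (\<lambda>n. v n \<odot>\<^bsub>X\<^esub> f n \<oplus>\<^bsub>X\<^esub> v n \<odot>\<^bsub>X\<^esub> g n) (rep_op V X f v \<oplus>\<^bsub>X\<^esub> rep_op V X g v)"
      using f g v fX coord_in_K by (intro X.series_sums_add rep_op_sums) auto
    then show "series_sums X (\<lambda>n. v n \<odot>\<^bsub>X\<^esub> (f n \<oplus>\<^bsub>X\<^esub> g n)) (rep_op V X f v \<oplus>\<^bsub>X\<^esub> rep_op V X g v)"
      using fX v coord_in_K by (simp add: X.smult_add_right)
  qed
  then have "rep_op V X (\<lambda>n. f n \<oplus>\<^bsub>X\<^esub> g n) = (\<lambda>v\<in>carrier V. rep_op V X f v \<oplus>\<^bsub>X\<^esub> rep_op V X g v)"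
    by (intro extensionalityI[of _ "carrier V"]) (auto simp: rep_op_def)
  then show ?thesis
    by (simp add: M_Sigma_def blin_space_def)
qed

lemma rep_op_smult:
  assumes f: "f \<in> carrier (M_Sigma V X)" and c: "c \<in> K"
  shows "rep_op V X (c \<odot>\<^bsub>M_Sigma V X\<^esub> f) = c \<odot>\<^bsub>blin_space K V X\<^esub> rep_op V X f"
proof -
  have fX: "f n \<in> carrier X" for n
    using f by (auto simp: M_Sigma_carrier)
  have "rep_op V X (\<lambda>n. c \<odot>\<^bsub>X\<^esub> f n) v = c \<odot>\<^bsub>X\<^esub> rep_op V X f v" if v: "v \<in> carrier V" for v
  proof (rule rep_op_eq[OF v])
    have "series_sums X (\<lambda>n. c \<odot>\<^bsub>X\<^esub> (v n \<odot>\<^bsub>X\<^esub> f n)) (c \<odot>\<^bsub>X\<^esub> rep_op V X f v)"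
      using f c v fX coord_in_K by (intro X.series_sums_smult rep_op_sums) auto
    moreover have "v n \<odot>\<^bsub>X\<^esub> (c \<odot>\<^bsub>X\<^esub> f n) = c \<odot>\<^bsub>X\<^esub> (v n \<odot>\<^bsub>X\<^esub> f n)" for n
      using fX c v coord_in_K by (simp add: mult.commute flip: X.smult_mult)
    ultimately show "series_sums X (\<lambda>n. v n \<odot>\<^bsub>X\<^esub> (c \<odot>\<^bsub>X\<^esub> f n)) (c \<odot>\<^bsub>X\<^esub> rep_op V X f v)"
      by simp
  qed
  then have "rep_op V X (\<lambda>n. c \<odot>\<^bsub>X\<^esub> f n) = (\<lambda>v\<in>carrier V. c \<odot>\<^bsub>X\<^esub> rep_op V X f v)"
    by (intro extensionalityI[of _ "carrier V"]) (auto simp: rep_op_def)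
  then show ?thesis
    by (simp add: M_Sigma_def blin_space_def)
qed

lemma linear_map_rep_op: "linear_map K (M_Sigma V X) (blin_space K V X) (rep_op V X)"
  unfolding linear_map_def using rep_op_in_blin rep_op_add rep_op_smult by blast

lemma inj_on_rep_op: "inj_on (rep_op V X) (carrier (M_Sigma V X))"
  by (intro inj_onI ext) (metis rep_op_canonical)

lemma nrm_rep_op: "nrm (blin_space K V X) (rep_op V X f) = nrm (M_Sigma V X) f"
  unfolding blin_space_def M_Sigma_def rep_op_def by (simp cong: image_cong_simp)

text \<open>Everything except surjectivity holds for every \<open>V\<close> and \<open>X\<close> of
  the locale, so both implications below concern surjectivity alone.\<close>

lemma isometric_isomorphism_rep_op_iff:
  "isometric_isomorphism K (M_Sigma V X) (blin_space K V X) (rep_op V X) \<longleftrightarrow>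
    carrier (blin_space K V X) \<subseteq> rep_op V X ` carrier (M_Sigma V X)"
  unfolding isometric_isomorphism_def bij_betw_def
  using linear_map_rep_op inj_on_rep_op nrm_rep_op rep_op_in_blin by blast

section \<open>Surjectivity of the representation operator and the basis property\<close>

text \<open>Links the two kinds of convergence: the partial sums of the only series that can
  represent \<open>T\<close> are the values of \<open>T\<close> at truncations.\<close>

lemma blin_trunc:
  assumes T: "linear_map K V X T" and v: "\<And>n. v n \<in> K"
  shows "T (trunc N v) = partial_sum (\<lambda>n. T (canonical_seq n)) N v"
proof -
  have TX: "T u \<in> carrier X" if "u \<in> carrier V" for u
    using T that by (auto simp: linear_map_def)
  have T0: "T \<zero>\<^bsub>V\<^esub> = \<zero>\<^bsub>X\<^esub>"
    using T V.smult_0[of "\<zero>\<^bsub>V\<^esub>"] X.smult_0[OF TX] V.of_real_scalar[of 0] unfolding linear_map_def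
    by (metis V.M.zero_closed of_real_0)
  show ?thesis
  proof (induction N)
    case (Suc N)
    have "T (trunc (Suc N) v) = T (v N \<odot>\<^bsub>V\<^esub> canonical_seq N) \<oplus>\<^bsub>X\<^esub> T (trunc N v)"
      unfolding trunc_Suc using T canonical trunc_carrier v V.smult_in_carrier
      unfolding linear_map_def by blast
    also have "T (v N \<odot>\<^bsub>V\<^esub> canonical_seq N) = v N \<odot>\<^bsub>X\<^esub> T (canonical_seq N)"
      using T canonical v unfolding linear_map_def by blast
    finally show ?case
      using Suc.IH v TX canonical by (simp add: partial_sum_Suc)
  qed (simp add: T0 trunc_0 partial_sum_0)
qed

lemma blin_diff:
  assumes T: "linear_map K V X T" and uv: "u \<in> carrier V" "v \<in> carrier V"
  shows "T (u \<ominus>\<^bsub>V\<^esub> v) = T u \<ominus>\<^bsub>X\<^esub> T v"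
proof -
  have "T (\<ominus>\<^bsub>V\<^esub> v) = \<ominus>\<^bsub>X\<^esub> T v"
    using T uv V.minus_one_scalar X.minus_one_smult[of "T v"] unfolding linear_map_def
    by (auto simp flip: V.minus_one_smult)
  then show ?thesis
    using T uv unfolding linear_map_def by (simp add: a_minus_def)
qed

theorem isometric_isomorphism_if_schauder:
  assumes "schauder_basis K V canonical_seq"
  shows "isometric_isomorphism K (M_Sigma V X) (blin_space K V X) (rep_op V X)"
  unfolding isometric_isomorphism_rep_op_iff
proof
  fix T assume T: "T \<in> carrier (blin_space K V X)"
  then have lin: "linear_map K V X T" and ext: "T \<in> extensional (carrier V)"
    by (auto simp: blin_space_def)
  obtain C where C: "\<And>v. v \<in> carrier V \<Longrightarrow> nrm X (T v) \<le> C * nrm V v"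
    using T by (auto simp: blin_space_def)
  have TX: "T v \<in> carrier X" if "v \<in> carrier V" for v
    using lin that by (auto simp: linear_map_def)
  define f where "f n = T (canonical_seq n)" for n
  have f: "f n \<in> carrier X" for n
    using TX canonical by (simp add: f_def)
  have sums: "series_sums X (\<lambda>n. v n \<odot>\<^bsub>X\<^esub> f n) (T v)" if v: "v \<in> carrier V" for v
  proof -
    note trunc = trunc_carrier[of v, OF coord_in_K[OF v]]
    have P: "partial_sum f N v = T (trunc N v)" for N
      using blin_trunc[OF lin, of v] coord_in_K[OF v] by (simp add: f_def[abs_def])
    have "(\<lambda>N. C * nrm V (trunc N v \<ominus>\<^bsub>V\<^esub> v)) \<longlonglongrightarrow> 0"
      using assms v by (intro tendsto_mult_right_zero) (simp add: schauder_basis_iff)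
    moreover have "norm (nrm X (partial_sum f N v \<ominus>\<^bsub>X\<^esub> T v)) \<le> C * nrm V (trunc N v \<ominus>\<^bsub>V\<^esub> v)" for N
      using C[of "trunc N v \<ominus>\<^bsub>V\<^esub> v"] v trunc TX
      by (simp add: P X.nrm_nonneg flip: blin_diff[OF lin])
    ultimately have "(\<lambda>N. nrm X (partial_sum f N v \<ominus>\<^bsub>X\<^esub> T v)) \<longlonglongrightarrow> 0"
      by (rule Lim_null_comparison[OF always_eventually[OF allI], rotated])
    then show ?thesis
      unfolding partial_sums_limitin using TX v f coord_in_K
      by (subst X.limitin_nrm) (auto intro: partial_sum_carrier)
  qed
  have "rep_op V X f = T"
    using rep_op_eq[OF _ sums] ext
    by (intro extensionalityI[of _ "carrier V"]) (auto simp: rep_op_def)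
  moreover have "f \<in> carrier (M_Sigma V X)"
    using f sums by (auto simp: M_Sigma_carrier)
  ultimately show "T \<in> rep_op V X ` carrier (M_Sigma V X)"
    by blast
qed

text \<open>By \<open>rep_op_canonical\<close> the sequence representing a rank-one operator
  consists of its values at the canonical sequences. Its partial sums at \<open>v\<close> are
  therefore scalar multiples of one vector \<open>x\<close>, and their convergence in
  \<open>X\<close> is convergence of the scalars.\<close>

lemma trunc_weakly_convergent:
  assumes iso: "isometric_isomorphism K (M_Sigma V X) (blin_space K V X) (rep_op V X)"
    and nonzero: "carrier X \<noteq> {\<zero>\<^bsub>X\<^esub>}"
    and \<phi>: "V.real_linear \<phi>" and le: "\<And>u. u \<in> carrier V \<Longrightarrow> \<bar>\<phi> u\<bar> \<le> B * nrm V u"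
    and v: "v \<in> carrier V"
  shows "(\<lambda>N. \<phi> (trunc N v)) \<longlonglongrightarrow> \<phi> v"
proof -
  \<comment> \<open>An operator into \<open>X\<close> has to be linear over \<open>K\<close>, and
    \<open>\<phi>\<close> is only real-linear. The real part is taken again at the end.\<close>
  obtain \<psi> where \<psi>K: "\<And>u. u \<in> carrier V \<Longrightarrow> \<psi> u \<in> K"
    and \<psi>_add: "\<And>u w. u \<in> carrier V \<Longrightarrow> w \<in> carrier V \<Longrightarrow> \<psi> (u \<oplus>\<^bsub>V\<^esub> w) = \<psi> u + \<psi> w"
    and \<psi>_smult: "\<And>c u. c \<in> K \<Longrightarrow> u \<in> carrier V \<Longrightarrow> \<psi> (c \<odot>\<^bsub>V\<^esub> u) = c * \<psi> u"
    and \<psi>_le: "\<And>u. u \<in> carrier V \<Longrightarrow> norm (\<psi> u) \<le> 2 * B * nrm V u"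
    and \<psi>_Re: "\<And>u. u \<in> carrier V \<Longrightarrow> Re (\<psi> u) = \<phi> u"
    using V.real_linear_Re[OF \<phi> le] by blast
  obtain x where x: "x \<in> carrier X" and "x \<noteq> \<zero>\<^bsub>X\<^esub>"
    using nonzero X.M.zero_closed by blast
  then have nrm_x: "nrm X x > 0"
    using X.nrm_eq_0_iff[OF x] X.nrm_nonneg[OF x] by linarith
  define T where "T = (\<lambda>u\<in>carrier V. \<psi> u \<odot>\<^bsub>X\<^esub> x)"
  have lin: "linear_map K V X T"
    using x \<psi>K by (auto simp: linear_map_def T_def \<psi>_add \<psi>_smult X.smult_add_left X.smult_mult)
  have "nrm X (T u) \<le> (2 * B * nrm X x) * nrm V u" if "u \<in> carrier V" for u
    using \<psi>_le[OF that] \<psi>K[OF that] x that nrm_x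
    by (simp add: T_def X.nrm_smult mult_right_mono mult.commute mult.left_commute)
  then have "T \<in> carrier (blin_space K V X)"
    using lin by (auto simp: blin_space_def T_def)
  then obtain f where f: "f \<in> carrier (M_Sigma V X)" and fT: "rep_op V X f = T"
    using iso unfolding isometric_isomorphism_rep_op_iff by blast
  note trunc = trunc_carrier[of v, OF coord_in_K[OF v]]
  have f_eq: "f = (\<lambda>n. T (canonical_seq n))"
    using rep_op_canonical[OF f] by (simp add: fT fun_eq_iff)
  have P: "partial_sum f N v = \<psi> (trunc N v) \<odot>\<^bsub>X\<^esub> x" for N
    using blin_trunc[OF lin, of v N] coord_in_K[OF v] trunc by (simp add: f_eq T_def)
  have "limitin (nrm_topology X) (\<lambda>N. \<psi> (trunc N v) \<odot>\<^bsub>X\<^esub> x) (\<psi> v \<odot>\<^bsub>X\<^esub> x) sequentially"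
    using rep_op_sums[OF f v] v unfolding partial_sums_limitin P by (simp add: fT T_def)
  then have "(\<lambda>N. nrm X (\<psi> (trunc N v) \<odot>\<^bsub>X\<^esub> x \<ominus>\<^bsub>X\<^esub> \<psi> v \<odot>\<^bsub>X\<^esub> x)) \<longlonglongrightarrow> 0"
    using x \<psi>K trunc by (simp add: X.limitin_nrm)
  moreover have "nrm X (\<psi> (trunc N v) \<odot>\<^bsub>X\<^esub> x \<ominus>\<^bsub>X\<^esub> \<psi> v \<odot>\<^bsub>X\<^esub> x) = norm (\<psi> (trunc N v) - \<psi> v) * nrm X x" for N
  proof -
    have "\<psi> (trunc N v) - \<psi> v \<in> K"
      using \<psi>K[OF trunc] \<psi>K[OF v] V.scalars by auto
    then show ?thesis
      using x \<psi>K[OF trunc] \<psi>K[OF v] by (simp add: X.nrm_smult flip: X.smult_diff_left)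
  qed
  \<comment> \<open>Here \<open>X\<close> being nonzero enters: \<open>nrm X x\<close> can be
    divided out.\<close>
  ultimately have "(\<lambda>N. norm (\<psi> (trunc N v) - \<psi> v) * nrm X x / nrm X x) \<longlonglongrightarrow> 0 / nrm X x"
    using nrm_x by (intro tendsto_divide) auto
  then have "(\<lambda>N. \<psi> (trunc N v)) \<longlonglongrightarrow> \<psi> v"
    using nrm_x by (simp add: tendsto_norm_zero_iff LIM_zero_iff)
  then have "(\<lambda>N. Re (\<psi> (trunc N v))) \<longlonglongrightarrow> Re (\<psi> v)"
    by (rule tendsto_Re)
  then show ?thesis
    using trunc v by (simp add: \<psi>_Re)
qed

text \<open>With \<open>V\<close> itself in the role of \<open>X\<close>, the truncations are the
  partial sums for the sequence \<open>canonical_seq\<close>, so \<open>partial_sums_bounded\<close>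
  applies.\<close>

lemma trunc_bounded_if_pointwise:
  assumes "\<And>v. v \<in> carrier V \<Longrightarrow> \<exists>B. \<forall>N. nrm V (trunc N v) \<le> B"
  obtains C where "\<And>N v. v \<in> carrier V \<Longrightarrow> nrm V (trunc N v) \<le> C * nrm V v"
proof -
  interpret VV: representation K V V
    by unfold_locales (use bk canonical in auto)
  have eq: "VV.partial_sum canonical_seq N v = trunc N v" if "v \<in> carrier V" for N v
    using coord_in_K[OF that] by (simp add: VV.partial_sum_def finsum_canonical)
  obtain C where "\<And>N v. v \<in> carrier V \<Longrightarrow> nrm V (VV.partial_sum canonical_seq N v) \<le> C * nrm V v"
  proof (rule VV.partial_sums_bounded[OF canonical])
    show "\<exists>B. \<forall>N. nrm V (VV.partial_sum canonical_seq N v) \<le> B" if "v \<in> carrier V" for v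
      using assms[OF that] by (simp add: eq[OF that])
  qed blast
  then have "nrm V (trunc N v) \<le> C * nrm V v" if "v \<in> carrier V" for N v
    using that by (metis eq)
  then show thesis
    by (rule that)
qed

text \<open>
  The truncations are uniformly bounded, so \<open>v \<mapsto> lim sup nrm V (v - trunc N v)\<close> is a sublinear
  functional. A real-linear functional below it vanishes on all finite sequences, hence by weak
  convergence everywhere; by Hahn-Banach the sublinear functional is zero.
\<close>

theorem schauder_if_isometric_isomorphism:
  assumes iso: "isometric_isomorphism K (M_Sigma V X) (blin_space K V X) (rep_op V X)"
    and nonzero: "carrier X \<noteq> {\<zero>\<^bsub>X\<^esub>}"
  shows "schauder_basis K V canonical_seq"
proof -
  have trunc: "trunc N v \<in> carrier V" if "v \<in> carrier V" for N v
    using that by (intro trunc_carrier coord_in_K)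
  note weak = trunc_weakly_convergent[OF iso nonzero]
  have "\<exists>B. \<forall>N. nrm V (trunc N v) \<le> B" if v: "v \<in> carrier V" for v
  proof (rule V.bounded_if_weakly_bounded[OF trunc[OF v]])
    fix \<phi> assume "V.real_linear \<phi>" "\<And>u. u \<in> carrier V \<Longrightarrow> \<bar>\<phi> u\<bar> \<le> 2 * nrm V u"
    then have "(\<lambda>N. \<phi> (trunc N v)) \<longlonglongrightarrow> \<phi> v"
      using weak v by blast
    then have "Bseq (\<lambda>N. \<phi> (trunc N v))"
      by (intro convergent_imp_Bseq convergentI)
    then show "\<exists>B. \<forall>N. \<bar>\<phi> (trunc N v)\<bar> \<le> B"
      by (auto simp: Bseq_def)
  qed
  then obtain C where C: "\<And>N v. v \<in> carrier V \<Longrightarrow> nrm V (trunc N v) \<le> C * nrm V v"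
    using trunc_bounded_if_pointwise by blast
  define r where "r v N = nrm V (trunc N v \<ominus>\<^bsub>V\<^esub> v)" for v N
  \<comment> \<open>\<open>C\<close> accounts for the truncation and 1 for \<open>v\<close>
    itself.\<close>
  have r_le: "r v N \<le> (C + 1) * nrm V v" if "v \<in> carrier V" for v N
    using V.nrm_triangle_diff[OF trunc[OF that] that, of N] C[OF that, of N]
    by (simp add: r_def algebra_simps)
  have r_nonneg: "0 \<le> r v N" if "v \<in> carrier V" for v N
    using that trunc by (simp add: r_def V.nrm_nonneg)
  \<comment> \<open>The upper limit is taken as the limit of the decreasing tail suprema, which lets
    inequalities between the \<open>s N\<close> pass to \<open>p\<close>.\<close>
  define s where "s N v = (SUP M\<in>{N..}. r v M)" for N v
  have bdd: "bdd_above (r v ` A)" if "v \<in> carrier V" for v A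
    using r_le[OF that] by (rule bdd_aboveI2)
  have le_s: "r v M \<le> s N v" if "v \<in> carrier V" "M \<ge> N" for v M N
    unfolding s_def using that bdd by (intro cSUP_upper) auto
  have s_le: "s N v \<le> b" if "\<And>M. M \<ge> N \<Longrightarrow> r v M \<le> b" for N v b
    unfolding s_def using that by (intro cSUP_least) auto
  define p where "p v = (INF N. s N v)" for v
  have s_nonneg: "0 \<le> s N v" if "v \<in> carrier V" for N v
    using le_s[OF that order_refl, of N] r_nonneg[OF that, of N] by linarith
  have bdd_s: "bdd_below (range (\<lambda>N. s N v))" if "v \<in> carrier V" for v
    using s_nonneg[OF that] by (rule bdd_belowI2)
  have lim: "(\<lambda>N. s N v) \<longlonglongrightarrow> p v" if v: "v \<in> carrier V" for v
    unfolding p_def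
  proof (rule LIMSEQ_decseq_INF)
    show "bdd_below (range (\<lambda>N. s N v))"
      by (rule bdd_s[OF v])
    show "decseq (\<lambda>N. s N v)"
      by (intro antimonoI s_le le_s v) auto
  qed
  have "V.sublinear p"
    unfolding V.sublinear_def
  proof (intro conjI ballI allI impI)
    fix u v assume uv: "u \<in> carrier V" "v \<in> carrier V"
    have "s N (u \<oplus>\<^bsub>V\<^esub> v) \<le> s N u + s N v" for N
    proof (rule s_le)
      fix M assume "M \<ge> N"
      moreover have "trunc M (u \<oplus>\<^bsub>V\<^esub> v) \<ominus>\<^bsub>V\<^esub> (u \<oplus>\<^bsub>V\<^esub> v)
          = (trunc M u \<ominus>\<^bsub>V\<^esub> u) \<oplus>\<^bsub>V\<^esub> (trunc M v \<ominus>\<^bsub>V\<^esub> v)"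
        using uv trunc by (simp add: diff_V fun_eq_iff) (simp add: add_V trunc_def)
      then have "r (u \<oplus>\<^bsub>V\<^esub> v) M \<le> r u M + r v M"
        using uv trunc by (simp add: r_def V.nrm_triangle)
      ultimately show "r (u \<oplus>\<^bsub>V\<^esub> v) M \<le> s N u + s N v"
        using le_s[OF uv(1)] le_s[OF uv(2)] by (meson add_mono order_trans)
    qed
    then show "p (u \<oplus>\<^bsub>V\<^esub> v) \<le> p u + p v"
      using uv by (intro LIMSEQ_le[OF lim tendsto_add[OF lim lim]]) auto
  next
    fix t :: real and v assume t: "0 \<le> t" and v: "v \<in> carrier V"
    have "s N (of_real t \<odot>\<^bsub>V\<^esub> v) \<le> t * s N v" for N
    proof (rule s_le)
      fix M assume "M \<ge> N"
      moreover have "trunc M (of_real t \<odot>\<^bsub>V\<^esub> v) \<ominus>\<^bsub>V\<^esub> (of_real t \<odot>\<^bsub>V\<^esub> v) = of_real t \<odot>\<^bsub>V\<^esub> (trunc M v \<ominus>\<^bsub>V\<^esub> v)"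
        using v trunc by (simp add: diff_V fun_eq_iff) (simp add: smult_V trunc_def algebra_simps)
      then have "r (of_real t \<odot>\<^bsub>V\<^esub> v) M = t * r v M"
        using t v trunc by (simp add: r_def V.nrm_smult_real)
      ultimately show "r (of_real t \<odot>\<^bsub>V\<^esub> v) M \<le> t * s N v"
        using le_s[OF v] t by (simp add: mult_left_mono)
    qed
    then show "p (of_real t \<odot>\<^bsub>V\<^esub> v) \<le> t * p v"
      using v by (intro LIMSEQ_le[OF lim tendsto_mult_left[OF lim]]) auto
  qed
  \<comment> \<open>Ensures that a functional below \<open>p\<close> is bounded, as
    \<open>weak\<close> requires.\<close>
  have p_le: "p v \<le> (C + 1) * nrm V v" if v: "v \<in> carrier V" for v
    using s_le[OF r_le[OF v]] by (intro LIMSEQ_le_const2[OF lim[OF v]]) auto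
  have p_finite: "p v \<le> 0" if v: "v \<in> carrier V" and fin: "\<And>M. M \<ge> N \<Longrightarrow> trunc M v = v" for v N
  proof -
    have "r v M = 0" if "M \<ge> N" for M
      using fin[OF that] v by (simp add: r_def V.M.minus_eq V.M.r_neg)
    then have "s N v \<le> 0"
      by (intro s_le) simp
    moreover have "p v \<le> s N v"
      unfolding p_def using bdd_s[OF v] by (intro cINF_lower) auto
    ultimately show ?thesis
      by simp
  qed
  have "r v \<longlonglongrightarrow> 0" if v: "v \<in> carrier V" for v
  proof -
    obtain \<phi> where \<phi>: "V.real_linear \<phi>" and \<phi>_le: "\<And>u. u \<in> carrier V \<Longrightarrow> \<phi> u \<le> p u"
      and \<phi>_v: "\<phi> v = p v"
      using V.Hahn_Banach[OF \<open>V.sublinear p\<close> v] by blast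
    \<comment> \<open>Finite sequences are closed under negation, so the upper bound by
      \<open>p\<close> applies with both signs.\<close>
    have "\<phi> (trunc N v) = 0" for N
    proof -
      have "p (trunc N v) \<le> 0"
        by (rule p_finite[OF trunc[OF v], of N]) (auto simp: trunc_def)
      then have "\<phi> (trunc N v) \<le> 0"
        using \<phi>_le[OF trunc[OF v], of N] by linarith
      moreover have "p (\<ominus>\<^bsub>V\<^esub> trunc N v) \<le> 0"
      proof (rule p_finite)
        show "\<ominus>\<^bsub>V\<^esub> trunc N v \<in> carrier V"
          using trunc[OF v] by simp
        show "trunc M (\<ominus>\<^bsub>V\<^esub> trunc N v) = \<ominus>\<^bsub>V\<^esub> trunc N v" if "M \<ge> N" for M
          using that trunc[OF v] by (auto simp: minus_V) (auto simp: trunc_def)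
      qed
      then have "\<phi> (\<ominus>\<^bsub>V\<^esub> trunc N v) \<le> 0"
        using \<phi>_le[of "\<ominus>\<^bsub>V\<^esub> trunc N v"] trunc[OF v] by fastforce
      ultimately show ?thesis
        using V.real_linear_minus[OF \<phi> trunc[OF v]] by simp
    qed
    moreover have "(\<lambda>N. \<phi> (trunc N v)) \<longlonglongrightarrow> \<phi> v"
    proof (rule weak[OF \<phi> _ v])
      show "\<bar>\<phi> u\<bar> \<le> (C + 1) * nrm V u" if "u \<in> carrier V" for u
        using V.real_linear_abs_le[OF \<phi> _ that] \<phi>_le p_le by (meson order_trans)
    qed
    \<comment> \<open>A sequence of zeros converges to \<open>\<phi> v\<close>, which was chosen
      equal to \<open>p v\<close>.\<close>
    ultimately have "p v = 0"
      using \<phi>_v by (simp add: LIMSEQ_const_iff)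
    then have "(\<lambda>N. s N v) \<longlonglongrightarrow> 0"
      using lim[OF v] by simp
    then show ?thesis
      by (rule Lim_null_comparison[rotated])
        (use le_s[OF v order_refl] r_nonneg[OF v] in auto)
  qed
  then show ?thesis
    by (simp add: schauder_basis_iff r_def[abs_def])
qed

end


section \<open>The characterization\<close>

text \<open>Transports \<open>K\<close>, as a one-dimensional space over itself, along
  \<open>j\<close> into the type \<open>'x\<close>. It is complete because \<open>K\<close> is
  closed in the complex numbers.\<close>

lemma banach_space_scalar_copy:
  fixes j :: "complex \<Rightarrow> 'x"
  assumes K: "K = \<real> \<or> K = UNIV" and j: "inj j"
  shows "\<exists>X :: 'x normed. banach_space K X \<and> carrier X \<noteq> {\<zero>\<^bsub>X\<^esub>}"
proof -
  define X :: "'x normed" where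
    "X = \<lparr>carrier = j ` K, monoid.mult = undefined, one = undefined, ring.zero = j 0,
          add = (\<lambda>x y. j (inv_into UNIV j x + inv_into UNIV j y)), smult = (\<lambda>c x. j (c * inv_into UNIV j x)),
          nrm = (\<lambda>x. norm (inv_into UNIV j x))\<rparr>"
  have inv_j [simp]: "inv_into UNIV j (j z) = z" for z
    using j by simp
  have carrier: "carrier X = j ` K" and zero: "\<zero>\<^bsub>X\<^esub> = j 0"
    and add: "j a \<oplus>\<^bsub>X\<^esub> j b = j (a + b)" and smult: "c \<odot>\<^bsub>X\<^esub> j a = j (c * a)"
    and nrm: "nrm X (j a) = norm a" for a b c
    by (simp_all add: X_def)
  have closed: "0 \<in> K" "1 \<in> K" "a \<in> K \<Longrightarrow> b \<in> K \<Longrightarrow> a + b \<in> K"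
    "a \<in> K \<Longrightarrow> b \<in> K \<Longrightarrow> a * b \<in> K" "a \<in> K \<Longrightarrow> - a \<in> K" for a b
    using K by auto
  have minus: "\<exists>b\<in>K. j (b + a) = j 0" if "a \<in> K" for a
    using closed(5)[OF that] by (intro bexI[of _ "- a"]) auto
  have "module (scalar_field K) X"
    using closed minus cring_scalar_field[OF K]
    by (intro moduleI abelian_groupI)
      (auto simp: scalar_field_def carrier zero add smult algebra_simps)
  then have normed: "normed_space K X"
    unfolding normed_space_def normed_space_axioms_def
    using j by (auto simp: carrier zero add smult nrm norm_triangle_ineq norm_mult inj_eq)
  interpret scalar_normed_space K X
    using normed K by (simp add: scalar_normed_space_def scalar_normed_space_axioms_def)
  have diff: "j a \<ominus>\<^bsub>X\<^esub> j b = j (a - b)" if "a \<in> K" "b \<in> K" for a b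
    using that minus_one_smult[of "j b", symmetric] by (simp add: a_minus_def carrier smult add)
  have dist: "nrm_dist X (j a) (j b) = dist a b" if "a \<in> K" "b \<in> K" for a b
    using that by (simp add: nrm_dist_def carrier diff nrm dist_norm)
  have "Met.mcomplete"
    unfolding Met.mcomplete_def
  proof (intro allI impI)
    fix \<sigma> assume \<sigma>: "Met.MCauchy \<sigma>"
    then have "range \<sigma> \<subseteq> carrier X"
      by (simp add: Met.MCauchy_def)
    then have "\<forall>n. \<exists>a\<in>K. \<sigma> n = j a"
      unfolding carrier by blast
    then obtain a where a: "\<And>n. a n \<in> K" and \<sigma>_eq: "\<And>n. \<sigma> n = j (a n)"
      by metis
    have "Cauchy a"
      using \<sigma> unfolding Met.MCauchy_def Cauchy_def by (simp add: \<sigma>_eq dist a)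
    then obtain l where lim: "a \<longlonglongrightarrow> l"
      using Cauchy_convergent convergent_def by blast
    have "closed K"
      using K closed_complex_Reals by auto
    then have l: "l \<in> K"
      using a lim closed_sequentially by blast
    have "(\<lambda>n. nrm X (\<sigma> n \<ominus>\<^bsub>X\<^esub> j l)) \<longlonglongrightarrow> 0"
      using lim a l by (simp add: \<sigma>_eq diff nrm tendsto_norm_zero_iff LIM_zero_iff)
    then have "limitin (nrm_topology X) \<sigma> (j l) sequentially"
      using a l by (subst limitin_nrm) (auto simp: \<sigma>_eq carrier)
    then show "\<exists>x. limitin Met.mtopology \<sigma> x sequentially"
      by (auto simp: nrm_topology_def)
  qed
  moreover have "j 1 \<in> carrier X" "j 1 \<noteq> \<zero>\<^bsub>X\<^esub>"
    using closed(2) j by (auto simp: carrier zero inj_eq)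
  ultimately show ?thesis
    using normed by (intro exI[of _ X]) (auto simp: banach_space_def)
qed

text \<open>All spaces \<open>X\<close> live in the single type \<open>'x\<close>, and
  \<open>universe\<close> makes this type large enough to carry a nonzero Banach space over
  \<open>K\<close>. In a type without one, the universal statement would be vacuous and the
  existential one false.\<close>

theorem theorem10p2:
  fixes K :: "complex set" and V :: "(nat \<Rightarrow> complex) normed"
  assumes scalars: "K = \<real> \<or> K = UNIV"
    and bk: "bk_space K V"
    and canonical: "\<forall>n. canonical_seq n \<in> carrier V"
    and universe: "\<exists>j :: complex \<Rightarrow> 'x. inj j"
  shows
    "(schauder_basis K V canonical_seq \<longleftrightarrow>
        (\<forall>X :: 'x normed. banach_space K X \<and> carrier X \<noteq> {\<zero>\<^bsub>X\<^esub>} \<longrightarrow>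
           isometric_isomorphism K (M_Sigma V X) (blin_space K V X) (rep_op V X))) \<and>
     (schauder_basis K V canonical_seq \<longleftrightarrow>
        (\<exists>X :: 'x normed. banach_space K X \<and> carrier X \<noteq> {\<zero>\<^bsub>X\<^esub>} \<and>
           isometric_isomorphism K (M_Sigma V X) (blin_space K V X) (rep_op V X)))"
proof -
  have "representation K V X" if "banach_space K X" for X :: "'x normed"
    using that scalars bk canonical
    by (simp add: representation_def representation_axioms_def scalar_normed_space_def
        scalar_normed_space_axioms_def banach_space_def bk_space_def)
  note iso = representation.isometric_isomorphism_if_schauder[OF this]
    and basis = representation.schauder_if_isometric_isomorphism[OF this]
  obtain X :: "'x normed" where "banach_space K X" "carrier X \<noteq> {\<zero>\<^bsub>X\<^esub>}"
    using banach_space_scalar_copy[OF scalars] universe by blast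
  then show ?thesis
    using iso basis by meson
qed

end
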